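(* Let $n\ge m$ be positive integers, let $A\in IMS2(n,m)$, and let $k$ be a non-negative integer. There exists a data structure that occupies ${\rm O}\left(4^k nm\left(\frac{n}{m}\right)^{\frac{1}{2^{2^k}}}\right)$ bits and that, given indices $(i,j)$, outputs the entry $A[i][j]$ in ${\rm O}(2^k)$ time.
   Context: $IMS2(n,m)$ is the set of two-dimensional integer arrays $A[0..n-1][0..n-1]$ satisfying three conditions: - $A[i][j]\le A[i][j+1]$ for $0\le i<n$ and $0\le j<n-1$; - $A[i][j]\le A[i+1][j]$ for $0\le i<n-1$ and $0\le j<n$; - $0\le A[i][j]<m$ for all $i,j$. Space is measured in bits, in the word-RAM model. *)

theory Defs
  imports Complex_Main
begin

text \<open>Only the entries with both indices below \<open>n\<close> belong to the array; the function
  is arbitrary elsewhere.\<close>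

definition IMS2 :: "nat \<Rightarrow> nat \<Rightarrow> (nat \<Rightarrow> nat \<Rightarrow> int) set" where
  "IMS2 n m = {A.
     (\<forall>i j. i < n \<and> j + 1 < n \<longrightarrow> A i j \<le> A i (j + 1)) \<and>
     (\<forall>i j. i + 1 < n \<and> j < n \<longrightarrow> A i j \<le> A (i + 1) j) \<and>
     (\<forall>i j. i < n \<and> j < n \<longrightarrow> 0 \<le> A i j \<and> A i j < int m)}"

text \<open>A word RAM with word length \<open>w\<close>, where \<open>w\<close> is a parameter of the semantics: words are
  natural numbers below \<open>2 ^ w\<close>, and since addresses are words, the memory has \<open>2 ^ w\<close>
  cells of \<open>w\<close> bits each. The program text is independent of \<open>w\<close>, but it can refer to the word
  length through the operand \<open>WordLen\<close>. Numerical constants are reduced to words.\<close>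

datatype operand = Reg nat | Const nat | WordLen

datatype binop = Add | Sub | Mul | Div | Mod | And | Or | Xor | Shl | Shr | Less | Equal

datatype com =
    Skip
  | Move nat operand
  | Op nat binop operand operand
  | Load nat operand
  | Store operand operand
  | Seq com com
  | If operand com com
  | While operand com

record state =
  regs :: "nat \<Rightarrow> nat"
  mem :: "nat \<Rightarrow> nat"

fun opval :: "nat \<Rightarrow> state \<Rightarrow> operand \<Rightarrow> nat" where
  "opval w s (Reg r) = regs s r"
| "opval w s (Const c) = take_bit w c"
| "opval w s WordLen = w"

text \<open>Addition, subtraction, multiplication and left shift wrap around modulo \<open>2 ^ w\<close>.\<close>

fun binop_val :: "nat \<Rightarrow> binop \<Rightarrow> nat \<Rightarrow> nat \<Rightarrow> nat" where
  "binop_val w Add a b = take_bit w (a + b)"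
| "binop_val w Sub a b = nat (take_bit w (int a - int b))"
| "binop_val w Mul a b = take_bit w (a * b)"
| "binop_val w Div a b = a div b"
| "binop_val w Mod a b = a mod b"
| "binop_val w And a b = Bit_Operations.and a b"
| "binop_val w Or a b = Bit_Operations.or a b"
| "binop_val w Xor a b = Bit_Operations.xor a b"
| "binop_val w Shl a b = take_bit w (push_bit b a)"
| "binop_val w Shr a b = drop_bit b a"
| "binop_val w Less a b = of_bool (a < b)"
| "binop_val w Equal a b = of_bool (a = b)"

text \<open>\<open>exec w c s t s'\<close>: on words of \<open>w\<close> bits, \<open>c\<close> started in \<open>s\<close> terminates in \<open>s'\<close> after
  \<open>t\<close> unit-cost steps. Every instruction and every evaluation of a branch or loop
  condition is one step; a condition holds iff it is nonzero.\<close>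

inductive exec :: "nat \<Rightarrow> com \<Rightarrow> state \<Rightarrow> nat \<Rightarrow> state \<Rightarrow> bool" for w :: nat where
  Skip: "exec w Skip s 1 s"
| Move: "exec w (Move d x) s 1 (s\<lparr>regs := (regs s)(d := opval w s x)\<rparr>)"
| Op: "exec w (Op d f x y) s 1
        (s\<lparr>regs := (regs s)(d := binop_val w f (opval w s x) (opval w s y))\<rparr>)"
| Load: "exec w (Load d a) s 1 (s\<lparr>regs := (regs s)(d := mem s (opval w s a))\<rparr>)"
| Store: "exec w (Store a x) s 1 (s\<lparr>mem := (mem s)(opval w s a := opval w s x)\<rparr>)"
| Seq: "exec w c1 s t1 s' \<Longrightarrow> exec w c2 s' t2 s'' \<Longrightarrow> exec w (Seq c1 c2) s (t1 + t2) s''"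
| IfTrue: "opval w s x \<noteq> 0 \<Longrightarrow> exec w c1 s t s' \<Longrightarrow> exec w (If x c1 c2) s (1 + t) s'"
| IfFalse: "opval w s x = 0 \<Longrightarrow> exec w c2 s t s' \<Longrightarrow> exec w (If x c1 c2) s (1 + t) s'"
| WhileFalse: "opval w s x = 0 \<Longrightarrow> exec w (While x c) s 1 s"
| WhileTrue: "opval w s x \<noteq> 0 \<Longrightarrow> exec w c s t1 s' \<Longrightarrow> exec w (While x c) s' t2 s'' \<Longrightarrow>
      exec w (While x c) s (1 + t1 + t2) s''"

text \<open>A data structure is the bit string left in memory by preprocessing, and its space is the
  length of that string. Cell \<open>a\<close> holds the bits \<open>a * w, \<dots>, a * w + w - 1\<close>, least
  significant first; all bits after the end of the string are 0.\<close>

definition packed :: "nat \<Rightarrow> bool list \<Rightarrow> nat \<Rightarrow> nat" where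
  "packed w D a = horner_sum of_bool 2 (take w (drop (a * w) D))"

definition query_state :: "nat \<Rightarrow> bool list \<Rightarrow> nat \<Rightarrow> nat \<Rightarrow> state" where
  "query_state w D i j = \<lparr>regs = (\<lambda>_. 0)(0 := i, 1 := j), mem = packed w D\<rparr>"

text \<open>The query receives nothing but the structure and the two indices (in registers 0 and 1);
  the answer is left in register 0.\<close>

definition accesses_in :: "nat \<Rightarrow> com \<Rightarrow> bool list \<Rightarrow> nat \<Rightarrow> (nat \<Rightarrow> nat \<Rightarrow> int) \<Rightarrow> real \<Rightarrow> bool" where
  "accesses_in w P D n A T \<longleftrightarrow>
     (\<forall>i<n. \<forall>j<n. \<exists>t s'. exec w P (query_state w D i j) t s' \<and>
        int (regs s' 0) = A i j \<and> real t \<le> T)"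

end

theory Submission imports Defs "HOL-Library.Log_Nat" begin

text \<open>The array, cut into dyadic blocks, is stored as a trie: a node for a block of size
  \<open>2 ^ e\<close> holds, for each of its subblocks of size \<open>2 ^ (3 * e div 4)\<close>, the value at the corner
  relative to the corner of the block and, unless the subblock is constant, the offset of its
  structure. By telescoping, the ranges of the blocks of size \<open>b\<close> add up to \<open>O (n m / b)\<close>, and
  a node costs only \<open>O (b)\<close> bits per unit of range, so a level takes \<open>O (n m)\<close> bits. Since the
  exponents shrink geometrically, \<open>O (2 ^ k)\<close> levels lead from size \<open>n / m\<close> to a size whose
  square is at most \<open>(n / m) powr (1 / 2 ^ 2 ^ k)\<close>, and such blocks can be stored explicitly.
  If \<open>n / m\<close> is smaller than \<open>log n\<close>, the trie starts at size about \<open>log n\<close> instead; after six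
  levels the blocks are so small that they are encoded by their level paths, and a table shared
  by all blocks decodes these codes.\<close>

section \<open>Words and bit strings\<close>

text \<open>The obstacle throughout is a logarithmic factor: values and offsets of log n bits
  everywhere would spoil the bound. Every node therefore has a field width of its own, adapted to
  the size and the range of its block. The exponent shrinks by the factor 3/4 because halving it
  would give a node of exponent \<open>e\<close> about \<open>2 ^ e\<close> entries, with no room
  for a width that is linear in \<open>e\<close>; with 3/4 there are only about
  \<open>2 ^ (e / 2)\<close> entries. The logarithm of the range is estimated by the range itself,
  which is the quantity that telescopes. The root, with blocks of size b, has about (n / b)^2
  entries of O(log n) bits, so b^2 must be at least of order (n / m) log n. The larger of n / m and
  log n satisfies this, whence the two starting sizes.\<close>

definition bits_val :: "bool list \<Rightarrow> nat" where
  "bits_val D = horner_sum of_bool 2 D"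

definition field :: "nat \<Rightarrow> nat \<Rightarrow> bool list" where
  "field L x = map (bit x) [0..<L]"

definition occurs_at :: "bool list \<Rightarrow> nat \<Rightarrow> bool list \<Rightarrow> bool" where
  "occurs_at D p xs \<longleftrightarrow> p + length xs \<le> length D \<and> take (length xs) (drop p D) = xs"

lemma length_field [simp]: "length (field L x) = L"
  by (simp add: field_def)

lemma bit_bits_val: "bit (bits_val D) k \<longleftrightarrow> k < length D \<and> D ! k"
  by (simp add: bits_val_def bit_horner_sum_bit_iff)

text \<open>Cells become windows into one large number, so that a read at an arbitrary bit address
  is a \<open>drop_bit\<close> followed by a \<open>take_bit\<close>.\<close>

lemma packed_eq: "packed w D a = take_bit w (drop_bit (a * w) (bits_val D))"
  by (rule bit_eqI)
     (auto simp: packed_def bit_horner_sum_bit_iff bit_take_bit_iff bit_drop_bit_eq bit_bits_val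
       min_def less_diff_conv2 add.commute)

text \<open>A window of \<open>w\<close> bits that starts inside a cell takes its low bits from that
  cell and the rest from the next one. For an aligned window the second operand is shifted out
  entirely.\<close>

lemma packed_straddle:
  assumes "0 < w"
  shows "Bit_Operations.or (drop_bit (p mod w) (packed w D (p div w)))
      (take_bit w (push_bit (w - p mod w) (packed w D (p div w + 1))))
    = take_bit w (drop_bit p (bits_val D))"
proof (rule bit_eqI)
  fix k
  let ?o = "p mod w" and ?X = "bits_val D"
  have o: "?o < w" using assms by simp
  have p: "p = p div w * w + ?o" by simp
  have e1: "w * (p div w) + ?o = p" by simp
  show "bit (Bit_Operations.or (drop_bit ?o (packed w D (p div w)))
      (take_bit w (push_bit (w - ?o) (packed w D (p div w + 1))))) k
    = bit (take_bit w (drop_bit p ?X)) k"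
  proof (cases "?o + k < w")
    case True
    then have "\<not> (w - ?o \<le> k)" by linarith
    moreover have "p div w * w + (?o + k) = p + k" using p by linarith
    ultimately show ?thesis using True
      by (simp add: packed_eq bit_or_iff bit_take_bit_iff bit_drop_bit_eq bit_push_bit_iff
          add.assoc)
  next
    case False
    then have "w - ?o \<le> k" by linarith
    moreover have "(p div w + 1) * w + (k - (w - ?o)) = p + k"
      using False o p unfolding add_mult_distrib by linarith
    moreover have "k < w \<Longrightarrow> k - (w - ?o) < w" by linarith
    ultimately show ?thesis using False
      by (auto simp add: packed_eq bit_or_iff bit_take_bit_iff bit_drop_bit_eq bit_push_bit_iff
           simp del: mult_Suc add_mult_distrib)
  qed
qed

lemma occurs_at_append:
  "occurs_at D p (xs @ ys) \<longleftrightarrow> occurs_at D p xs \<and> occurs_at D (p + length xs) ys"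
  (is "?l = ?r")
proof -
  have "take (length xs + length ys) (drop p D)
      = take (length xs) (drop p D) @ take (length ys) (drop (p + length xs) D)"
    by (simp add: take_add add.commute)
  then show ?thesis
    by (auto simp: occurs_at_def)
qed

lemma occurs_at_concat:
  assumes "occurs_at D p (concat (map f [0..<K]))" "k < K"
  shows "occurs_at D (p + (\<Sum>i<k. length (f i))) (f k)"
proof -
  have "[0..<K] = [0..<k] @ k # [Suc k..<K]"
    using assms(2) upt_add_eq_append[of 0 k "K - k"] by (simp add: upt_conv_Cons)
  then have "concat (map f [0..<K])
      = concat (map f [0..<k]) @ f k @ concat (map f [Suc k..<K])" by simp
  moreover have "length (concat (map f [0..<k])) = (\<Sum>i<k. length (f i))"
    by (simp add: length_concat o_def interv_sum_list_conv_sum_set_nat atLeast0LessThan)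
  ultimately show ?thesis using assms(1) by (simp add: occurs_at_append)
qed

lemma read_field:
  assumes "occurs_at D p (field L x)" "x < 2 ^ L" "L \<le> w"
  shows "take_bit w (drop_bit p (bits_val D)) mod 2 ^ L = x"
proof -
  have "bit (take_bit L (drop_bit p (bits_val D))) k = bit x k" for k
  proof (cases "k < L")
    case True
    have "p + L \<le> length D" and t: "take L (drop p D) = map (bit x) [0..<L]"
      using assms(1) by (auto simp: occurs_at_def field_def)
    moreover have "take L (drop p D) ! k = D ! (p + k)"
      using True \<open>p + L \<le> length D\<close> by simp
    ultimately show ?thesis using True
      by (auto simp: bit_take_bit_iff bit_drop_bit_eq bit_bits_val)
  next
    case False
    then show ?thesis using assms(2)
      by (metis bit_take_bit_iff take_bit_nat_eq_self_iff)
  qed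
  then have "take_bit L (drop_bit p (bits_val D)) = x" by (intro bit_eqI) auto
  then show ?thesis using assms(3)
    by (simp add: take_bit_eq_mod[symmetric] min_def)
qed

text \<open>The lowest set bit of the first field is bit \<open>W\<close>, so that a header can be decoded
  without knowing \<open>W\<close>.\<close>

definition header :: "nat \<Rightarrow> nat \<Rightarrow> nat \<Rightarrow> bool list" where
  "header W a b = field (2 * W + 1) (2 ^ W + 2 ^ (W + 1) * W) @ field W a @ field W b"

lemma length_header [simp]: "length (header W a b) = 4 * W + 1"
  by (simp add: header_def)

text \<open>Subtracting 1 flips exactly the bits up to the lowest set bit, so the result is a mask
  of \<open>W + 1\<close> ones. The program can thus compute \<open>2 ^ W\<close> from the header
  alone.\<close>

lemma xor_pred_lowbit:
  "Bit_Operations.xor (2 ^ W + 2 ^ (W + 1) * z) (2 ^ W + 2 ^ (W + 1) * z - 1) = (2 ^ (W + 1) - 1 :: nat)"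
proof -
  have b: "bit (a + 2 ^ (W + 1) * z) k = (if k \<le> W then bit a k else bit z (k - (W + 1)))"
    if "a < 2 ^ (W + 1)" for a k :: nat
  proof -
    have "take_bit (W + 1) (a + 2 ^ (W + 1) * z) = a"
      using that by (simp add: take_bit_eq_mod del: power_Suc)
    moreover have "drop_bit (W + 1) (a + 2 ^ (W + 1) * z) = z"
      using that by (simp add: drop_bit_eq_div del: power_Suc)
    ultimately show ?thesis
      by (cases "k \<le> W")
         (metis bit_take_bit_iff less_Suc_eq_le Suc_eq_plus1,
          metis bit_drop_bit_eq comp_apply le_add_diff_inverse not_less_eq_eq Suc_eq_plus1)
  qed
  have lt: "(2::nat) ^ W - 1 < 2 ^ (W + 1)" "(2::nat) ^ W < 2 ^ (W + 1)"
    by (simp_all add: less_imp_diff_less)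
  have 1: "bit (2 ^ W + 2 ^ (W + 1) * z) k \<longleftrightarrow> (if k < W then False else k = W \<or> bit z (k - (W + 1)))"
    for k unfolding b[OF lt(2)] by (auto simp: bit_exp_iff)
  have 2: "bit (2 ^ W + 2 ^ (W + 1) * z - 1) k
      \<longleftrightarrow> (if k < W then True else k \<noteq> W \<and> bit z (k - (W + 1)))" for k
  proof -
    have e: "2 ^ W + 2 ^ (W + 1) * z - 1 = (2 ^ W - 1) + 2 ^ (W + 1) * z" by simp
    have m: "bit (2 ^ W - 1 :: nat) k \<longleftrightarrow> k < W"
      unfolding mask_eq_exp_minus_1[symmetric] by (simp add: bit_mask_iff)
    show ?thesis unfolding e b[OF lt(1)] m by auto
  qed
  have 3: "bit (2 ^ (W + 1) - 1 :: nat) k \<longleftrightarrow> k < W + 1" for k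
    unfolding mask_eq_exp_minus_1[symmetric] by (simp add: bit_mask_iff)
  show ?thesis
  proof (rule bit_eqI)
    fix k
    show "bit (Bit_Operations.xor (2 ^ W + 2 ^ (W + 1) * z) (2 ^ W + 2 ^ (W + 1) * z - 1)) k
      = bit (2 ^ (W + 1) - 1 :: nat) k"
      unfolding bit_xor_iff 1 2 3 by auto
  qed
qed

section \<open>Functional semantics and worst-case cost of loop-free programs\<close>

fun loop_free :: "com \<Rightarrow> bool" where
  "loop_free (Seq c d) \<longleftrightarrow> loop_free c \<and> loop_free d"
| "loop_free (If x c d) \<longleftrightarrow> loop_free c \<and> loop_free d"
| "loop_free (While x c) \<longleftrightarrow> False"
| "loop_free _ \<longleftrightarrow> True"

fun run :: "nat \<Rightarrow> com \<Rightarrow> state \<Rightarrow> state" where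
  "run w (Move d x) s = s\<lparr>regs := (regs s)(d := opval w s x)\<rparr>"
| "run w (Op d f x y) s
    = s\<lparr>regs := (regs s)(d := binop_val w f (opval w s x) (opval w s y))\<rparr>"
| "run w (Load d a) s = s\<lparr>regs := (regs s)(d := mem s (opval w s a))\<rparr>"
| "run w (Store a x) s = s\<lparr>mem := (mem s)(opval w s a := opval w s x)\<rparr>"
| "run w (Seq c d) s = run w d (run w c s)"
| "run w (If x c d) s = (if opval w s x \<noteq> 0 then run w c s else run w d s)"
| "run w _ s = s"

fun cost :: "com \<Rightarrow> nat" where
  "cost (Seq c d) = cost c + cost d"
| "cost (If x c d) = 1 + max (cost c) (cost d)"
| "cost _ = 1"

text \<open>Turns loop-free code into a function on states, so that only the single loop of the
  query needs the relational semantics.\<close>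

lemma exec_run:
  "loop_free c \<Longrightarrow> \<exists>t \<le> cost c. exec w c s t (run w c s)"
proof (induction c arbitrary: s)
  case (Seq c1 c2)
  then obtain t1 t2 where "t1 \<le> cost c1" "exec w c1 s t1 (run w c1 s)"
    "t2 \<le> cost c2" "exec w c2 (run w c1 s) t2 (run w c2 (run w c1 s))" by force
  then show ?case by (intro exI[of _ "t1 + t2"]) (auto intro: exec.Seq)
next
  case (If x c1 c2)
  then obtain t1 t2 where "t1 \<le> cost c1" "exec w c1 s t1 (run w c1 s)"
    "t2 \<le> cost c2" "exec w c2 s t2 (run w c2 s)" by force
  then show ?case
    using exec.IfTrue[of w s x c1 t1 _ c2] exec.IfFalse[of w s x c2 t2 _ c1]
    by (cases "opval w s x = 0") (auto intro: exI[of _ "1 + t1"] exI[of _ "1 + t2"])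
qed (auto intro!: exI[of _ 1] exec.Skip exec.Move exec.Op exec.Load exec.Store)

fun seq :: "com list \<Rightarrow> com" where
  "seq [] = Skip"
| "seq [c] = c"
| "seq (c # cs) = Seq c (seq cs)"

definition read_word :: "nat \<Rightarrow> nat \<Rightarrow> com" where
  "read_word a d = seq [
     Op 14 Div (Reg a) WordLen,
     Op 15 Mod (Reg a) WordLen,
     Load d (Reg 14),
     Op d Shr (Reg d) (Reg 15),
     Op 14 Add (Reg 14) (Const 1),
     Load 14 (Reg 14),
     Op 15 Sub WordLen (Reg 15),
     Op 14 Shl (Reg 14) (Reg 15),
     Op d Or (Reg d) (Reg 14)]"

lemma run_read_word:
  assumes "mem s = packed w D" "regs s a < 2 ^ w" "1 < w" "a < 14" "d < 14"
  shows "\<exists>u v. run w (read_word a d) s = s\<lparr>regs := (regs s)(15 := v, 14 := u,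
    d := take_bit w (drop_bit (regs s a) (bits_val D)))\<rparr>"
proof -
  let ?p = "regs s a"
  \<comment> \<open>The address of the second cell must not wrap around; as \<open>w\<close> exceeds
    1, the quotient is smaller than the bit address unless that is 0.\<close>
  have "?p div w + 1 < 2 ^ w"
  proof (cases "?p = 0")
    case True
    then show ?thesis using assms(3) one_less_power[of "2::nat" w] by simp
  next
    case False
    then have "?p div w < ?p" using assms(3) by simp
    then show ?thesis using assms(2) by linarith
  qed
  then have 1: "take_bit w (Suc (?p div w)) = Suc (?p div w)"
    by (simp add: take_bit_nat_eq_self)
  have "w - ?p mod w < 2 ^ w"
    using less_exp[of w] by linarith
  then have 2: "nat (take_bit w (int w - int (?p mod w))) = w - ?p mod w"
    using assms(3)
    by (metis of_nat_diff take_bit_of_nat nat_int take_bit_nat_eq_self mod_le_divisor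
        zero_less_one less_trans)
  show ?thesis
    by (rule exI[of _ "take_bit w (push_bit (w - ?p mod w) (packed w D (Suc (?p div w))))"],
        rule exI[of _ "w - ?p mod w"])
       (use assms(1,3-5) packed_straddle[of w ?p D] 1 2 in
         \<open>simp add: read_word_def fun_upd_twist\<close>)
qed

section \<open>The query program\<close>

text \<open>Registers: 0 and 1 hold the indices local to the current block, 2 the accumulated value, 3 the
  current bit address, 4 and 5 the address and the record size of the table, 6 to 9 the header
  data \<open>W\<close>, \<open>2 ^ W\<close> and the two further fields, 10 the loop condition, and the others are
  scratch.\<close>

definition read_header :: com where
  "read_header = seq [
     read_word 3 6,
     Op 8 Sub (Reg 6) (Const 1),
     Op 8 Xor (Reg 6) (Reg 8),
     Op 8 Add (Reg 8) (Const 1),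
     Op 7 Shr (Reg 8) (Const 1),
     Op 6 Div (Reg 6) (Reg 8),
     Op 6 Mod (Reg 6) (Reg 7),
     Op 3 Add (Reg 3) (Reg 6),
     Op 3 Add (Reg 3) (Reg 6),
     Op 3 Add (Reg 3) (Const 1),
     read_word 3 8,
     Op 8 Mod (Reg 8) (Reg 7),
     Op 3 Add (Reg 3) (Reg 6),
     read_word 3 9,
     Op 9 Mod (Reg 9) (Reg 7),
     Op 3 Add (Reg 3) (Reg 6)]"

text \<open>Register 10 receives the stored offset and doubles as the loop condition: 0 ends the
  loop, and any other value is one more than the distance of the child from the end of the entries,
  whence the final subtraction.\<close>

definition descend :: com where
  "descend = seq [
     Op 11 Div (Reg 0) (Reg 8),
     Op 11 Mul (Reg 11) (Reg 9),
     Op 12 Div (Reg 1) (Reg 8),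
     Op 11 Add (Reg 11) (Reg 12),
     Op 0 Mod (Reg 0) (Reg 8),
     Op 1 Mod (Reg 1) (Reg 8),
     Op 11 Mul (Reg 11) (Reg 6),
     Op 11 Add (Reg 11) (Reg 11),
     Op 11 Add (Reg 11) (Reg 3),
     read_word 11 12,
     Op 12 Mod (Reg 12) (Reg 7),
     Op 2 Add (Reg 2) (Reg 12),
     Op 11 Add (Reg 11) (Reg 6),
     read_word 11 10,
     Op 10 Mod (Reg 10) (Reg 7),
     Op 9 Mul (Reg 9) (Reg 9),
     Op 9 Mul (Reg 9) (Reg 6),
     Op 9 Add (Reg 9) (Reg 9),
     Op 3 Add (Reg 3) (Reg 9),
     Op 3 Add (Reg 3) (Reg 10),
     Op 3 Sub (Reg 3) (Const 1)]"

definition jump :: com where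
  "jump = seq [
     Op 9 Add (Reg 7) (Reg 9),
     Op 9 Mul (Reg 9) (Reg 5),
     Op 3 Add (Reg 4) (Reg 9)]"

definition body :: com where
  "body = Seq read_header (If (Reg 8) descend jump)"

text \<open>The whole structure opens with a header of the same format as a node; its fields hold
  the length of the root and the record size, and the table starts right behind the root.\<close>

definition prologue :: com where
  "prologue = seq [
     read_header,
     Op 4 Add (Reg 3) (Reg 8),
     Move 5 (Reg 9),
     Move 10 (Const 1)]"

definition query :: com where
  "query = Seq prologue (Seq (While (Reg 10) body) (Move 0 (Reg 2)))"

lemma loop_free_body: "loop_free body" and loop_free_prologue: "loop_free prologue"
  by (simp_all add: body_def prologue_def read_header_def descend_def jump_def read_word_def)

section \<open>Effect of the program fragments on states\<close>

lemma take_bit_sub: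
  "b \<le> a \<Longrightarrow> a < 2 ^ w \<Longrightarrow> nat (take_bit w (int a - int b)) = a - b"
  by (metis less_imp_diff_less nat_int of_nat_diff take_bit_nat_eq_self take_bit_of_nat)

lemma take_bit_id: "a < 2 ^ w \<Longrightarrow> take_bit w a = (a :: nat)"
  by (rule take_bit_nat_eq_self)

lemma run_read_header:
  assumes mem: "mem s = packed w D" and len: "length D < 2 ^ w"
    and at: "occurs_at D (regs s 3) (header W a b)" and W: "0 < W" "2 * W + 1 \<le> w"
    and a: "a < 2 ^ W" and b: "b < 2 ^ W"
  shows "\<exists>u v. run w read_header s = s\<lparr>regs := (regs s)(3 := regs s 3 + 4 * W + 1, 6 := W,
    7 := 2 ^ W, 8 := a, 9 := b, 14 := u, 15 := v)\<rparr>"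
proof -
  let ?p = "regs s 3" and ?X = "bits_val D"
  define x where "x = take_bit w (drop_bit ?p ?X)"
  have w: "1 < w" using W by linarith
  have at1: "occurs_at D ?p (field (2 * W + 1) (2 ^ W + 2 ^ (W + 1) * W))"
    and at2: "occurs_at D (?p + 2 * W + 1) (field W a)"
    and at3: "occurs_at D (?p + 3 * W + 1) (field W b)"
    using at by (simp_all add: header_def occurs_at_append algebra_simps)
  have pl: "?p + 4 * W + 1 < 2 ^ w"
    using at len by (simp add: occurs_at_def)
  \<comment> \<open>The width fits into the upper \<open>W\<close> bits of the first field because
    \<open>W < 2 ^ W\<close>.\<close>
  have "2 ^ W + 2 ^ (W + 1) * W < (2::nat) ^ (2 * W + 1)"
  proof -
    have "2 ^ W + 2 ^ (W + 1) * W < 2 ^ (W + 1) * (W + 1)" by simp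
    also have "\<dots> \<le> 2 ^ (W + 1) * (2::nat) ^ W"
      by (rule mult_left_mono) (use less_exp[of W] in \<open>simp_all add: Suc_le_eq\<close>)
    also have "\<dots> = 2 ^ (2 * W + 1)"
      unfolding power_add[symmetric] by (simp add: mult_2)
    finally show ?thesis .
  qed
  then have x: "x mod 2 ^ (2 * W + 1) = 2 ^ W + 2 ^ (W + 1) * W"
    using read_field[OF at1] W(2) by (simp add: x_def)
  \<comment> \<open>The program cannot cut the word at the end of the field before it knows
    \<open>W\<close>. So \<open>z\<close> is everything above the lowest set bit: \<open>W\<close>
    followed by unrelated bits, which the reduction modulo \<open>2 ^ W\<close> removes.\<close>
  define z where "z = W + 2 ^ W * (x div 2 ^ (2 * W + 1))"
  have xz: "x = 2 ^ W + 2 ^ (W + 1) * z"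
  proof -
    have "x = 2 ^ W + 2 ^ (W + 1) * W + 2 ^ (2 * W + 1) * (x div 2 ^ (2 * W + 1))"
      using mod_mult_div_eq[of x "2 ^ (2 * W + 1)"] by (simp only: x)
    moreover have "(2::nat) ^ (2 * W + 1) = 2 ^ (W + 1) * 2 ^ W"
      unfolding power_add[symmetric] by (simp add: mult_2)
    ultimately show ?thesis
      unfolding z_def by (metis distrib_left mult.assoc add.assoc)
  qed
  have xw: "x < 2 ^ w" by (simp add: x_def)
  have x1: "1 \<le> x" using xz by (simp add: Suc_leI)
  have xor: "Bit_Operations.xor x (x - 1) = 2 ^ (W + 1) - 1"
    unfolding xz by (rule xor_pred_lowbit)
  have W1: "(2::nat) ^ (W + 1) < 2 ^ w"
    using W by (intro power_strict_increasing) auto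
  have sh: "drop_bit 1 (2 ^ (W + 1) :: nat) = 2 ^ W"
    by (simp add: drop_bit_eq_div)
  have dv: "x div 2 ^ (W + 1) = z"
    unfolding xz by (simp del: power_Suc add: div_add1_eq)
  have md: "z mod 2 ^ W = W" using less_exp[of W] by (simp add: z_def)
  have c1: "take_bit w (1::nat) = 1" using w by (simp add: take_bit_id)
  have s1: "nat (take_bit w (int x - int 1)) = x - 1"
    using x1 xw by (rule take_bit_sub)
  have r2: "take_bit w (drop_bit (?p + 2 * W + 1) ?X) mod 2 ^ W = a"
    using read_field[OF at2 a] W by simp
  have r3: "take_bit w (drop_bit (?p + 3 * W + 1) ?X) mod 2 ^ W = b"
    using read_field[OF at3 b] W by simp
  define s1 where "s1 = run w (read_word 3 6) s"
  obtain u1 v1 where s1: "s1 = s\<lparr>regs := (regs s)(15 := v1, 14 := u1, 6 := x)\<rparr>"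
    using run_read_word[OF mem, of 3 6] pl w unfolding s1_def x_def by auto
  define c2 where "c2 = seq [
     Op 8 Sub (Reg 6) (Const 1),
     Op 8 Xor (Reg 6) (Reg 8),
     Op 8 Add (Reg 8) (Const 1),
     Op 7 Shr (Reg 8) (Const 1),
     Op 6 Div (Reg 6) (Reg 8),
     Op 6 Mod (Reg 6) (Reg 7)]"
  define s2 where "s2 = run w c2 s1"
  have s2: "s2 = s\<lparr>regs := (regs s)(14 := u1, 15 := v1, 6 := W, 7 := 2 ^ W, 8 := 2 ^ (W + 1))\<rparr>"
    using c1 s1 take_bit_sub[OF x1 xw] xor sh dv md W1
    by (simp add: s2_def c2_def take_bit_id fun_upd_twist fun_eq_iff del: power_Suc)
  define c3 where "c3 = seq [
     Op 3 Add (Reg 3) (Reg 6),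
     Op 3 Add (Reg 3) (Reg 6),
     Op 3 Add (Reg 3) (Const 1)]"
  define s3 where "s3 = run w c3 s2"
  have s3: "s3 = s\<lparr>regs := (regs s)(14 := u1, 15 := v1, 6 := W, 7 := 2 ^ W, 8 := 2 ^ (W + 1),
      3 := ?p + 2 * W + 1)\<rparr>"
    using c1 pl by (simp add: s3_def c3_def s2 take_bit_id fun_eq_iff)
  define s4 where "s4 = run w (read_word 3 8) s3"
  have m3: "mem s3 = packed w D" and e3: "regs s3 3 = ?p + 2 * W + 1" using mem by (simp_all add: s3)
  obtain u4 v4 where s4: "s4 = s3\<lparr>regs := (regs s3)(15 := v4, 14 := u4,
      8 := take_bit w (drop_bit (?p + 2 * W + 1) ?X))\<rparr>"
    using run_read_word[OF m3, of 3 8] e3 pl w unfolding s4_def by auto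
  define s5 where "s5 = run w (seq [Op 8 Mod (Reg 8) (Reg 7), Op 3 Add (Reg 3) (Reg 6)]) s4"
  have s5: "s5 = s\<lparr>regs := (regs s)(6 := W, 7 := 2 ^ W,
      14 := u4, 15 := v4, 8 := a, 3 := ?p + 3 * W + 1)\<rparr>"
    using r2 pl by (simp add: s5_def s4 s3 take_bit_id fun_eq_iff)
  define s6 where "s6 = run w (read_word 3 9) s5"
  have m5: "mem s5 = packed w D" and e5: "regs s5 3 = ?p + 3 * W + 1" using mem by (simp_all add: s5)
  obtain u6 v6 where s6: "s6 = s5\<lparr>regs := (regs s5)(15 := v6, 14 := u6,
      9 := take_bit w (drop_bit (?p + 3 * W + 1) ?X))\<rparr>"
    using run_read_word[OF m5, of 3 9] e5 pl w unfolding s6_def by auto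
  have "run w read_header s
      = run w (seq [Op 9 Mod (Reg 9) (Reg 7), Op 3 Add (Reg 3) (Reg 6)]) s6"
    unfolding read_header_def s6_def s5_def s4_def s3_def c3_def s2_def c2_def s1_def
    by (simp only: seq.simps run.simps(5))
  also have "\<dots> = s\<lparr>regs := (regs s)(3 := ?p + 4 * W + 1, 6 := W,
    7 := 2 ^ W, 8 := a, 9 := b, 14 := u6, 15 := v6)\<rparr>"
    using r3 pl by (simp add: s6 s5 take_bit_id fun_eq_iff)
  finally show ?thesis by blast
qed

lemma run_jump:
  assumes "y + b < 2 ^ w" "(y + b) * S < 2 ^ w" "G + (y + b) * S < 2 ^ w"
    and "regs s 7 = y" "regs s 9 = b" "regs s 5 = S" "regs s 4 = G"
  shows "\<exists>u. run w jump s = s\<lparr>regs := (regs s)(9 := u, 3 := G + (y + b) * S)\<rparr>"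
  using assms by (auto simp: jump_def take_bit_id fun_eq_iff)

lemma run_descend:
  fixes p W q c :: nat
  defines "e \<equiv> \<lambda>i j. p + (i div c * q + j div c) * (2 * W)"
  assumes mem: "mem s = packed w D" and len: "length D + 1 < 2 ^ w"
    and W: "0 < W" "W \<le> w" and lo: "lo < 2 ^ W" and d: "d < 2 ^ W"
    and ij: "regs s 0 = i" "regs s 1 = j" "j div c < q" "i div c < q"
    and r: "regs s 3 = p" "regs s 6 = W" "regs s 7 = 2 ^ W" "regs s 8 = c" "regs s 9 = q"
    and acc: "regs s 2 + lo < 2 ^ w"
    and at: "occurs_at D (e i j) (field W lo @ field W d)"
    and fits: "p + q * q * (2 * W) \<le> length D"
    and nxt: "d \<noteq> 0 \<Longrightarrow> p + q * q * (2 * W) + d \<le> length D + 1"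
  shows "\<exists>s'. run w descend s = s' \<and> mem s' = mem s \<and> regs s' 0 = i mod c \<and> regs s' 1 = j mod c
     \<and> regs s' 2 = regs s 2 + lo \<and> regs s' 4 = regs s 4 \<and> regs s' 5 = regs s 5 \<and> regs s' 10 = d
     \<and> (d \<noteq> 0 \<longrightarrow> regs s' 3 = p + q * q * (2 * W) + (d - 1))"
proof -
  let ?X = "bits_val D"
  let ?k = "i div c * q + j div c"
  let ?e = "p + ?k * (2 * W)"
  have w: "1 < w"
  proof -
    have "q * q * (2 * W) \<ge> 1" using ij W by (simp add: Suc_leI)
    then have "2 < (2::nat) ^ w" using len fits by linarith
    then have "(2::nat) ^ 1 < 2 ^ w" by simp
    then show ?thesis by (simp only: power_strict_increasing_iff)
  qed
  have at1: "occurs_at D ?e (field W lo)" and at2: "occurs_at D (?e + W) (field W d)"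
    and el: "?e + 2 * W \<le> length D"
    using at unfolding occurs_at_append e_def by (auto simp: occurs_at_def)
  have r1: "take_bit w (drop_bit ?e ?X) mod 2 ^ W = lo"
    using read_field[OF at1 lo] W by simp
  have r2: "take_bit w (drop_bit (?e + W) ?X) mod 2 ^ W = d"
    using read_field[OF at2 d] W by simp
  have kW: "?k \<le> ?k * W" using W by simp
  have k2: "?k * (2 * W) = ?k * W + ?k * W" by simp
  \<comment> \<open>All intermediate results are bounded by addresses inside the entry, which lies
    in \<open>D\<close>, so no operation wraps around.\<close>
  have b: "?k < 2 ^ w" "?k * W < 2 ^ w" "?k * W + ?k * W < 2 ^ w" "?e < 2 ^ w" "?e + W < 2 ^ w"
    "i div c * q < 2 ^ w"
    using el len kW k2 by linarith+
  have qW: "q * q \<le> q * q * W" "q * q * (2 * W) = q * q * W + q * q * W" using W by simp_all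
  have b2: "q * q < 2 ^ w" "q * q * W < 2 ^ w" "q * q * W + q * q * W < 2 ^ w"
    "p + (q * q * W + q * q * W) < 2 ^ w"
    using fits len qW by linarith+
  have c1: "take_bit w (1::nat) = 1" using w by (simp add: take_bit_id)
  define s1 where "s1 = run w (seq [Op 11 Div (Reg 0) (Reg 8),
     Op 11 Mul (Reg 11) (Reg 9),
     Op 12 Div (Reg 1) (Reg 8),
     Op 11 Add (Reg 11) (Reg 12),
     Op 0 Mod (Reg 0) (Reg 8),
     Op 1 Mod (Reg 1) (Reg 8),
     Op 11 Mul (Reg 11) (Reg 6),
     Op 11 Add (Reg 11) (Reg 11),
     Op 11 Add (Reg 11) (Reg 3)]) s"
  have s1: "s1 = s\<lparr>regs := (regs s)(0 := i mod c, 1 := j mod c, 11 := ?e, 12 := j div c)\<rparr>"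
    using ij r b k2 by (simp add: s1_def take_bit_id fun_eq_iff add_mult_distrib ac_simps)
  have m1: "mem s1 = packed w D" and e1: "regs s1 11 = ?e" using mem by (simp_all add: s1)
  obtain u v where s2: "run w (read_word 11 12) s1
      = s1\<lparr>regs := (regs s1)(15 := v, 14 := u, 12 := take_bit w (drop_bit ?e ?X))\<rparr>"
    using run_read_word[OF m1, of 11 12] e1 b w by auto
  define s3 where "s3 = run w (seq [Op 12 Mod (Reg 12) (Reg 7),
     Op 2 Add (Reg 2) (Reg 12),
     Op 11 Add (Reg 11) (Reg 6)]) (run w (read_word 11 12) s1)"
  have s3: "s3 = s\<lparr>regs := (regs s)(0 := i mod c, 1 := j mod c, 11 := ?e + W,
       14 := u, 15 := v, 12 := lo, 2 := regs s 2 + lo)\<rparr>"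
    using r b r1 acc unfolding s3_def s2 by (simp add: s1 take_bit_id fun_eq_iff)
  have m3: "mem s3 = packed w D" and e3: "regs s3 11 = ?e + W" using mem by (simp_all add: s3)
  obtain u v where s4: "run w (read_word 11 10) s3
      = s3\<lparr>regs := (regs s3)(15 := v, 14 := u, 10 := take_bit w (drop_bit (?e + W) ?X))\<rparr>"
    using run_read_word[OF m3, of 11 10] e3 b w by auto
  define s5 where "s5 = run w (seq [Op 10 Mod (Reg 10) (Reg 7),
     Op 9 Mul (Reg 9) (Reg 9),
     Op 9 Mul (Reg 9) (Reg 6),
     Op 9 Add (Reg 9) (Reg 9),
     Op 3 Add (Reg 3) (Reg 9)]) (run w (read_word 11 10) s3)"
  have s5: "s5 = s\<lparr>regs := (regs s)(0 := i mod c, 1 := j mod c, 11 := ?e + W,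
       12 := lo, 2 := regs s 2 + lo, 14 := u, 15 := v, 10 := d, 9 := q * q * (2 * W),
       3 := p + q * q * (2 * W))\<rparr>"
    using r b2[THEN take_bit_id] r2 qW(2) unfolding s5_def s4 by (simp add: s3 take_bit_id fun_eq_iff)
  define s6 where "s6 = run w (seq [Op 3 Add (Reg 3) (Reg 10), Op 3 Sub (Reg 3) (Const 1)]) s5"
  have "run w descend s = s6"
    unfolding descend_def s6_def s5_def s3_def s1_def
    by (simp only: seq.simps run.simps(5))
  moreover have "regs s6 3 = p + q * q * (2 * W) + (d - 1)" if "d \<noteq> 0"
  proof -
    have "p + q * q * (2 * W) + d < 2 ^ w" using nxt[OF that] len by linarith
    moreover from this have "nat (take_bit w (int (p + q * q * (2 * W) + d) - int 1))
      = p + q * q * (2 * W) + d - 1"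
      using that by (intro take_bit_sub) auto
    ultimately show ?thesis using that c1 by (simp add: s6_def s5 take_bit_id)
  qed
  ultimately show ?thesis using mem ij r by (simp add: s6_def s5)
qed

text \<open>\<open>lookup D w G S p i j v t\<close>: the structure at bit address \<open>p\<close> of \<open>D\<close> sends the local
  indices \<open>i\<close>, \<open>j\<close> to the value \<open>v\<close> in \<open>t\<close> rounds. A header whose first field is 0 is a
  reference into a table of records of \<open>S\<close> bits at address \<open>G\<close>; the summand \<open>2 ^ W\<close>
  separates the codes of different widths. Offsets are stored plus one, 0 meaning that there
  is no child.\<close>

inductive lookup :: "bool list \<Rightarrow> nat \<Rightarrow> nat \<Rightarrow> nat \<Rightarrow> nat \<Rightarrow> nat \<Rightarrow> nat \<Rightarrow> nat \<Rightarrow> nat \<Rightarrow> bool"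
  for D w G S where
  stop: "occurs_at D p (header W c q) \<Longrightarrow> 0 < W \<Longrightarrow> 2 * W + 1 \<le> w \<Longrightarrow> c < 2 ^ W \<Longrightarrow> q < 2 ^ W \<Longrightarrow>
    0 < c \<Longrightarrow> i div c < q \<Longrightarrow> j div c < q \<Longrightarrow> v < 2 ^ W \<Longrightarrow>
    occurs_at D (p + (4 * W + 1) + (i div c * q + j div c) * (2 * W)) (field W v @ field W 0) \<Longrightarrow>
    p + (4 * W + 1) + q * q * (2 * W) \<le> length D \<Longrightarrow>
    lookup D w G S p i j v 1"
| child: "occurs_at D p (header W c q) \<Longrightarrow> 0 < W \<Longrightarrow> 2 * W + 1 \<le> w \<Longrightarrow> c < 2 ^ W \<Longrightarrow> q < 2 ^ W \<Longrightarrow>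
    0 < c \<Longrightarrow> i div c < q \<Longrightarrow> j div c < q \<Longrightarrow> lo < 2 ^ W \<Longrightarrow> d + 1 < 2 ^ W \<Longrightarrow>
    occurs_at D (p + (4 * W + 1) + (i div c * q + j div c) * (2 * W)) (field W lo @ field W (d + 1)) \<Longrightarrow>
    p + (4 * W + 1) + q * q * (2 * W) + d \<le> length D \<Longrightarrow>
    lookup D w G S (p + (4 * W + 1) + q * q * (2 * W) + d) (i mod c) (j mod c) v t \<Longrightarrow>
    lookup D w G S p i j (lo + v) (t + 1)"
| table: "occurs_at D p (header W 0 code) \<Longrightarrow> 0 < W \<Longrightarrow> 2 * W + 1 \<le> w \<Longrightarrow> code < 2 ^ W \<Longrightarrow>
    (2 ^ W + code) * S + G \<le> length D \<Longrightarrow> 0 < S \<Longrightarrow>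
    lookup D w G S (G + (2 ^ W + code) * S) i j v t \<Longrightarrow>
    lookup D w G S p i j v (t + 1)"

lemma exec_body: "\<exists>t \<le> cost body. exec w body s t (run w body s)"
  by (rule exec_run[OF loop_free_body])

text \<open>Every rule of \<open>lookup\<close> is one iteration: the body plus a successful test of
  the condition. The additional step is the final test, which fails. The values met on the way add
  up in register 2.\<close>

lemma exec_loop:
  assumes "lookup D w G S p i j v t" "length D + 1 < 2 ^ w"
    "mem s = packed w D" "regs s 0 = i" "regs s 1 = j" "regs s 3 = p" "regs s 4 = G" "regs s 5 = S"
    "regs s 10 \<noteq> 0" "regs s 2 + v < 2 ^ w"
  shows "\<exists>t' s'. exec w (While (Reg 10) body) s t' s' \<and> t' \<le> (cost body + 1) * t + 1
    \<and> regs s' 2 = regs s 2 + v"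
  using assms
proof (induction arbitrary: s rule: lookup.induct)
  case (stop p W c q i j v)
  obtain t where t: "t \<le> cost body" "exec w body s t (run w body s)" using exec_body by blast
  obtain u u' where h: "run w read_header s = s\<lparr>regs := (regs s)(3 := p + 4 * W + 1, 6 := W,
    7 := 2 ^ W, 8 := c, 9 := q, 14 := u, 15 := u')\<rparr>" (is "_ = ?s")
    using run_read_header[of s w D W c q] stop by auto
  have "\<exists>s'. run w descend ?s = s' \<and> mem s' = mem ?s \<and> regs s' 0 = i mod c \<and> regs s' 1 = j mod c
     \<and> regs s' 2 = regs ?s 2 + v \<and> regs s' 4 = regs ?s 4 \<and> regs s' 5 = regs ?s 5 \<and> regs s' 10 = 0
     \<and> (0 \<noteq> (0::nat) \<longrightarrow> regs s' 3 = p + (4 * W + 1) + q * q * (2 * W) + (0 - 1))"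
    by (rule run_descend[where D = D and w = w]) (use stop in \<open>auto\<close>)
  then have "regs (run w body s) 10 = 0" "regs (run w body s) 2 = regs s 2 + v"
    using stop.hyps by (auto simp: body_def h)
  then show ?case
    using t exec.WhileTrue[OF _ t(2) exec.WhileFalse, of "Reg 10"] stop.prems
    by (intro exI[of _ "1 + t + 1"] exI[of _ "run w body s"]) auto
next
  case (child p W c q i j lo d v t0)
  obtain t where t: "t \<le> cost body" "exec w body s t (run w body s)" using exec_body by blast
  obtain u u' where h: "run w read_header s = s\<lparr>regs := (regs s)(3 := p + 4 * W + 1, 6 := W,
    7 := 2 ^ W, 8 := c, 9 := q, 14 := u, 15 := u')\<rparr>" (is "_ = ?s")
    using run_read_header[of s w D W c q] child by auto
  have "\<exists>s'. run w descend ?s = s' \<and> mem s' = mem ?s \<and> regs s' 0 = i mod c \<and> regs s' 1 = j mod c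
     \<and> regs s' 2 = regs ?s 2 + lo \<and> regs s' 4 = regs ?s 4 \<and> regs s' 5 = regs ?s 5 \<and> regs s' 10 = d + 1
     \<and> (d + 1 \<noteq> 0 \<longrightarrow> regs s' 3 = p + (4 * W + 1) + q * q * (2 * W) + (d + 1 - 1))"
    by (rule run_descend[where D = D and w = w]) (use child in \<open>auto\<close>)
  then have r: "mem (run w body s) = mem s" "regs (run w body s) 0 = i mod c"
     "regs (run w body s) 1 = j mod c" "regs (run w body s) 2 = regs s 2 + lo"
     "regs (run w body s) 4 = regs s 4" "regs (run w body s) 5 = regs s 5"
     "regs (run w body s) 10 \<noteq> 0"
     "regs (run w body s) 3 = p + (4 * W + 1) + q * q * (2 * W) + d"
    using child.hyps by (auto simp: body_def h)
  obtain t' s' where s': "exec w (While (Reg 10) body) (run w body s) t' s'"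
    "t' \<le> (cost body + 1) * t0 + 1" "regs s' 2 = regs s 2 + lo + v"
    using child.IH[of "run w body s"] child.prems r by auto
  then show ?case
    using t exec.WhileTrue[OF _ t(2) s'(1)] child.prems
    by (intro exI[of _ "1 + t + t'"] exI[of _ s']) auto
next
  case (table p W code i j v t0)
  obtain t where t: "t \<le> cost body" "exec w body s t (run w body s)" using exec_body by blast
  obtain u u' where h: "run w read_header s = s\<lparr>regs := (regs s)(3 := p + 4 * W + 1, 6 := W,
    7 := 2 ^ W, 8 := 0, 9 := code, 14 := u, 15 := u')\<rparr>" (is "_ = ?s")
    using run_read_header[of s w D W 0 code] table by auto
  have m: "2 ^ W + code \<le> (2 ^ W + code) * S" using table.hyps by simp
  have "\<exists>u. run w jump ?s = ?s\<lparr>regs := (regs ?s)(9 := u, 3 := G + (2 ^ W + code) * S)\<rparr>"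
  proof (rule run_jump)
    show "2 ^ W + code < 2 ^ w" "(2 ^ W + code) * S < 2 ^ w" "G + (2 ^ W + code) * S < 2 ^ w"
      using m table.hyps(5) table.prems(1) by linarith+
  qed (use table.prems in auto)
  then have r: "mem (run w body s) = mem s" "regs (run w body s) 0 = i"
     "regs (run w body s) 1 = j" "regs (run w body s) 2 = regs s 2"
     "regs (run w body s) 4 = regs s 4" "regs (run w body s) 5 = regs s 5"
     "regs (run w body s) 10 = regs s 10"
     "regs (run w body s) 3 = G + (2 ^ W + code) * S"
    using table.prems by (auto simp: body_def h)
  obtain t' s' where s': "exec w (While (Reg 10) body) (run w body s) t' s'"
    "t' \<le> (cost body + 1) * t0 + 1" "regs s' 2 = regs s 2 + v"
    using table.IH[of "run w body s"] table.prems r by auto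
  then show ?case
    using t exec.WhileTrue[OF _ t(2) s'(1)] table.prems
    by (intro exI[of _ "1 + t + t'"] exI[of _ s']) auto
qed

lemma exec_query:
  assumes "occurs_at D 0 (header W R S)" "0 < W" "2 * W + 1 \<le> w" "R < 2 ^ W" "S < 2 ^ W"
    and "lookup D w (4 * W + 1 + R) S (4 * W + 1) i j v t" "length D + 1 < 2 ^ w"
    and "4 * W + 1 + R \<le> length D" "v < 2 ^ w"
  shows "\<exists>t' s'. exec w query (query_state w D i j) t' s' \<and> regs s' 0 = v
    \<and> t' \<le> (cost body + 1) * t + cost prologue + 2"
proof -
  let ?s = "query_state w D i j"
  obtain u u' where h: "run w read_header ?s = ?s\<lparr>regs := (regs ?s)(3 := 4 * W + 1, 6 := W,
    7 := 2 ^ W, 8 := R, 9 := S, 14 := u, 15 := u')\<rparr>"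
    using run_read_header[of ?s w D W R S] assms by (auto simp: query_state_def)
  have c1: "take_bit w (1::nat) = 1" using assms(3) assms(2) one_less_power[of "2::nat" w]
    by (simp add: take_bit_id)
  obtain t1 where t1: "t1 \<le> cost prologue" "exec w prologue ?s t1 (run w prologue ?s)"
    using exec_run[OF loop_free_prologue] by blast
  have "4 * W + 1 + R < 2 ^ w" using assms(7,8) by linarith
  then have r: "mem (run w prologue ?s) = packed w D" "regs (run w prologue ?s) 0 = i"
    "regs (run w prologue ?s) 1 = j" "regs (run w prologue ?s) 3 = 4 * W + 1"
    "regs (run w prologue ?s) 4 = 4 * W + 1 + R" "regs (run w prologue ?s) 5 = S"
    "regs (run w prologue ?s) 10 \<noteq> 0" "regs (run w prologue ?s) 2 = 0"
    using c1 by (simp_all add: prologue_def h take_bit_id) (simp_all add: query_state_def)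
  have "\<exists>t' s'. exec w (While (Reg 10) body) (run w prologue ?s) t' s'
      \<and> t' \<le> (cost body + 1) * t + 1 \<and> regs s' 2 = regs (run w prologue ?s) 2 + v"
    by (rule exec_loop[OF assms(6,7)]) (use r assms(9) in \<open>simp_all\<close>)
  then obtain t2 s' where s': "exec w (While (Reg 10) body) (run w prologue ?s) t2 s'"
    "t2 \<le> (cost body + 1) * t + 1" "regs s' 2 = v"
    using r(8) by auto
  have "exec w query ?s (t1 + (t2 + 1)) (s'\<lparr>regs := (regs s')(0 := opval w s' (Reg 2))\<rparr>)"
    unfolding query_def by (rule exec.Seq[OF t1(2) exec.Seq[OF s'(1) exec.Move]])
  then show ?thesis using t1(1) s'(2,3)
    by (intro exI[of _ "t1 + (t2 + 1)"] exI[of _ "s'\<lparr>regs := (regs s')(0 := opval w s' (Reg 2))\<rparr>"])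
       simp
qed

section \<open>Encoding a monotone array as a trie\<close>

text \<open>Entries have equal width, so the one for a subblock is found by arithmetic; children
  differ in length, so their offsets have to be stored. An empty child marks a constant
  subblock.\<close>

definition node :: "nat \<Rightarrow> nat \<Rightarrow> nat \<Rightarrow> (nat \<Rightarrow> nat) \<Rightarrow> (nat \<Rightarrow> bool list) \<Rightarrow> bool list" where
  "node W c q lo sub = header W c q
    @ concat (map (\<lambda>k. field W (lo k)
        @ field W (if sub k = [] then 0 else (\<Sum>l<k. length (sub l)) + 1)) [0..<q * q])
    @ concat (map sub [0..<q * q])"

lemma length_concat_upt: "length (concat (map f [0..<K])) = (\<Sum>k<K. length (f k))"
  by (simp add: length_concat o_def interv_sum_list_conv_sum_set_nat atLeast0LessThan)

lemma length_node:
  "length (node W c q lo sub) = 4 * W + 1 + q * q * (2 * W) + (\<Sum>k<q * q. length (sub k))"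
  unfolding node_def length_append length_concat_upt by simp

lemma occurs_at_node_sub:
  assumes "occurs_at D p (node W c q lo sub)" "k < q * q"
  shows "occurs_at D (p + (4 * W + 1) + q * q * (2 * W) + (\<Sum>l<k. length (sub l))) (sub k)"
proof -
  have "occurs_at D (p + (4 * W + 1) + q * q * (2 * W)) (concat (map sub [0..<q * q]))"
    using assms(1) unfolding node_def occurs_at_append length_append length_concat_upt
    by (simp add: mult_2)
  from occurs_at_concat[OF this assms(2)] show ?thesis .
qed

text \<open>Without a child the entry itself is the answer, so the remainder \<open>v\<close> must
  vanish; with one, the child supplies \<open>v\<close> one round later. The hypothesis
  \<open>fits\<close> keeps every stored offset within its field.\<close>

lemma lookup_node:
  assumes at: "occurs_at D p (node W c q lo sub)"
    and W: "0 < W" "2 * W + 1 \<le> w" "c < 2 ^ W" "q < 2 ^ W" "0 < c" 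
    and ij: "i div c < q" "j div c < q"
  defines "k \<equiv> i div c * q + j div c"
  assumes lo: "lo k < 2 ^ W" and fits: "(\<Sum>l<q * q. length (sub l)) + 1 < 2 ^ W"
    and zero: "sub k = [] \<Longrightarrow> v = 0"
    and rec: "sub k \<noteq> [] \<Longrightarrow> \<exists>t\<le>T. lookup D w G S
      (p + (4 * W + 1) + q * q * (2 * W) + (\<Sum>l<k. length (sub l))) (i mod c) (j mod c) v t"
  shows "\<exists>t\<le>T + 1. lookup D w G S p i j (lo k + v) t"
proof -
  let ?d = "\<Sum>l<k. length (sub l)"
  have k: "k < q * q"
  proof -
    have "k < i div c * q + q" using ij by (simp add: k_def)
    also have "\<dots> = (i div c + 1) * q" by simp
    also have "\<dots> \<le> q * q" using ij by (intro mult_right_mono) auto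
    finally show ?thesis .
  qed
  have h: "occurs_at D p (header W c q)" using at by (simp add: node_def occurs_at_append)
  define ent where "ent = (\<lambda>k. field W (lo k)
        @ field W (if sub k = [] then 0 else (\<Sum>l<k. length (sub l)) + 1))"
  have "occurs_at D (p + (4 * W + 1)) (concat (map ent [0..<q * q]))"
    using at by (simp add: node_def occurs_at_append ent_def)
  from occurs_at_concat[OF this k]
  have e: "occurs_at D (p + (4 * W + 1) + k * (2 * W)) (ent k)"
    by (simp add: ent_def mult_2)
  have all: "p + length (node W c q lo sub) \<le> length D" using at by (simp add: occurs_at_def)
  have d: "?d \<le> (\<Sum>l<q * q. length (sub l))"
    using k by (intro sum_mono2) auto
  show ?thesis
  proof (cases "sub k = []")
    case True
    have "lookup D w G S p i j (lo k) 1"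
      by (rule lookup.stop[OF h W(1-4,5) ij lo])
         (use e True all in \<open>simp_all add: ent_def k_def length_node\<close>)
    then show ?thesis using zero[OF True] by (intro exI[of _ 1]) auto
  next
    case False
    then obtain t where t: "t \<le> T" "lookup D w G S
      (p + (4 * W + 1) + q * q * (2 * W) + ?d) (i mod c) (j mod c) v t" using rec by blast
    have "lookup D w G S p i j (lo k + v) (t + 1)"
      by (rule lookup.child[OF h W(1-4,5) ij lo _ _ _ t(2)])
         (use e False all d fits in \<open>simp_all add: ent_def k_def length_node\<close>)
    then show ?thesis using t(1) by (intro exI[of _ "t + 1"]) auto
  qed
qed

section \<open>Monotone arrays, dyadic blocks and their ranges\<close>

definition mono2 :: "(nat \<Rightarrow> nat \<Rightarrow> nat) \<Rightarrow> bool" where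
  "mono2 A \<longleftrightarrow> (\<forall>i i' j j'. i \<le> i' \<longrightarrow> j \<le> j' \<longrightarrow> A i j \<le> A i' j')"

lemma mono2D: "mono2 A \<Longrightarrow> i \<le> i' \<Longrightarrow> j \<le> j' \<Longrightarrow> A i j \<le> A i' j'"
  by (simp add: mono2_def)

definition rng :: "(nat \<Rightarrow> nat \<Rightarrow> nat) \<Rightarrow> nat \<Rightarrow> nat \<Rightarrow> nat \<Rightarrow> nat" where
  "rng A e x y = A (x + (2 ^ e - 1)) (y + (2 ^ e - 1)) - A x y"

lemma rng_0 [simp]: "rng A 0 x y = 0"
  by (simp add: rng_def)

lemma block_diff_le_rng:
  "mono2 A \<Longrightarrow> i < 2 ^ e \<Longrightarrow> j < 2 ^ e \<Longrightarrow> A (x + i) (y + j) - A x y \<le> rng A e x y"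
  unfolding rng_def by (intro diff_le_mono mono2D[of A]) auto

lemma subblock_inside:
  fixes I :: nat
  assumes "c \<le> e" "I < 2 ^ (e - c)" "i < 2 ^ c"
  shows "I * 2 ^ c + i < 2 ^ e"
proof -
  have "I * 2 ^ c + i < (I + 1) * 2 ^ c" using assms by simp
  also have "\<dots> \<le> 2 ^ (e - c) * 2 ^ c" using assms by (intro mult_right_mono) auto
  also have "\<dots> = 2 ^ e" using assms by (simp flip: power_add)
  finally show ?thesis .
qed

lemma rng_subblock_le:
  assumes "mono2 A" "c \<le> e" "I < 2 ^ (e - c)" "J < 2 ^ (e - c)"
  shows "rng A c (x + I * 2 ^ c) (y + J * 2 ^ c) \<le> rng A e x y"
proof -
  have "I * 2 ^ c + (2 ^ c - 1) < 2 ^ e" "J * 2 ^ c + (2 ^ c - 1) < 2 ^ e"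
    by (rule subblock_inside; use assms in simp)+
  then have "A (x + I * 2 ^ c + (2 ^ c - 1)) (y + J * 2 ^ c + (2 ^ c - 1))
      \<le> A (x + (2 ^ e - 1)) (y + (2 ^ e - 1))"
    by (intro mono2D[OF assms(1)]) linarith+
  moreover have "A x y \<le> A (x + I * 2 ^ c) (y + J * 2 ^ c)"
    by (intro mono2D[OF assms(1)]) auto
  ultimately show ?thesis unfolding rng_def by linarith
qed

text \<open>A block of size \<open>2 ^ e\<close> and range \<open>r\<close> takes at most \<open>2 ^ (4 * e + 8) * r\<close> bits, so this width
  suffices for the offsets.\<close>

definition width :: "nat \<Rightarrow> nat \<Rightarrow> nat" where
  "width e r = 4 * e + 10 + floorlog 2 r"

text \<open>The range bound \<open>r\<close> and the base value \<open>a\<close> are separate from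
  the block: inner nodes take its own range and corner, the root takes \<open>m\<close> and 0, and a
  table record takes the cap \<open>\<beta>\<close> and 0, so that all records have the same
  length.\<close>

definition block_node :: "(nat \<Rightarrow> nat \<Rightarrow> nat) \<Rightarrow> nat \<Rightarrow> nat \<Rightarrow> nat \<Rightarrow> nat \<Rightarrow> nat \<Rightarrow> nat
    \<Rightarrow> (nat \<Rightarrow> nat \<Rightarrow> bool list) \<Rightarrow> bool list" where
  "block_node A e c r a x y S = node (width e r) (2 ^ c) (2 ^ (e - c))
    (\<lambda>k. A (x + k div 2 ^ (e - c) * 2 ^ c) (y + k mod 2 ^ (e - c) * 2 ^ c) - a)
    (\<lambda>k. if rng A c (x + k div 2 ^ (e - c) * 2 ^ c) (y + k mod 2 ^ (e - c) * 2 ^ c) = 0 then []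
      else S (x + k div 2 ^ (e - c) * 2 ^ c) (y + k mod 2 ^ (e - c) * 2 ^ c))"

lemma sum_div_mod:
  fixes h :: "nat \<Rightarrow> nat \<Rightarrow> 'a :: comm_monoid_add"
  shows "(\<Sum>k<p * q. h (k div q) (k mod q)) = (\<Sum>I<p. \<Sum>J<q. h I J)"
proof (cases "q = 0")
  case False
  have "(\<Sum>k<p * q. h (k div q) (k mod q))
      = (\<Sum>I<p. \<Sum>k\<in>{I * q..<I * q + q}. h (k div q) (k mod q))"
    by (rule sum.nat_group[symmetric])
  also have "\<dots> = (\<Sum>I<p. \<Sum>J<q. h I J)"
  proof (rule sum.cong[OF refl])
    fix I
    have "(\<Sum>k\<in>{I * q..<I * q + q}. h (k div q) (k mod q))
        = (\<Sum>J<q. h ((I * q + J) div q) ((I * q + J) mod q))"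
      by (rule sum.reindex_bij_witness[of _ "\<lambda>J. I * q + J" "\<lambda>k. k - I * q"]) auto
    also have "\<dots> = (\<Sum>J<q. h I J)"
      by (rule sum.cong) auto
    finally show "(\<Sum>k\<in>{I * q..<I * q + q}. h (k div q) (k mod q)) = (\<Sum>J<q. h I J)" .
  qed
  finally show ?thesis .
qed simp

lemma length_block_node:
  "length (block_node A e c r a x y S) =
    4 * width e r + 1 + 2 ^ (e - c) * 2 ^ (e - c) * (2 * width e r)
    + (\<Sum>I<2 ^ (e - c). \<Sum>J<2 ^ (e - c). if rng A c (x + I * 2 ^ c) (y + J * 2 ^ c) = 0 then 0
        else length (S (x + I * 2 ^ c) (y + J * 2 ^ c)))"
  unfolding block_node_def length_node sum_div_mod[symmetric]
  by (intro arg_cong2[where f = "(+)"] sum.cong) auto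

lemma less_two_power_floorlog: "r < 2 ^ floorlog 2 r"
  by (cases "r = 0") (use floorlog_bounds[of r 2] in auto)

lemma two_power_square: "2 ^ (2 * k) = (2 ^ k * 2 ^ k :: nat)"
  unfolding mult_2 power_add ..

text \<open>The stored corner relative to \<open>a\<close> and the recursive answer relative to that
  corner add up to the value relative to \<open>a\<close>. The length bound in \<open>small\<close>
  makes the offsets fit, and its positivity lets an empty string stand for constant subblocks
  only.\<close>

lemma lookup_block_node:
  assumes A: "mono2 A" and at: "occurs_at D p (block_node A e c r a x y S)"
    and c: "c \<le> e" and ij: "i < 2 ^ e" "j < 2 ^ e"
    and a: "a \<le> A x y" "A (x + (2 ^ e - 1)) (y + (2 ^ e - 1)) - a \<le> r"
    and w: "2 * width e r + 1 \<le> w"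
    and small: "\<And>x y. rng A c x y \<noteq> 0 \<Longrightarrow>
      0 < length (S x y) \<and> length (S x y) \<le> 2 ^ (4 * c + 8) * rng A c x y"
    and rec: "\<And>I J p' i' j'. I < 2 ^ (e - c) \<Longrightarrow> J < 2 ^ (e - c) \<Longrightarrow>
      rng A c (x + I * 2 ^ c) (y + J * 2 ^ c) \<noteq> 0 \<Longrightarrow> i' < 2 ^ c \<Longrightarrow> j' < 2 ^ c \<Longrightarrow>
      occurs_at D p' (S (x + I * 2 ^ c) (y + J * 2 ^ c)) \<Longrightarrow>
      \<exists>t\<le>T. lookup D w G Z p' i' j' (A (x + I * 2 ^ c + i') (y + J * 2 ^ c + j')
        - A (x + I * 2 ^ c) (y + J * 2 ^ c)) t"
  shows "\<exists>t\<le>T + 1. lookup D w G Z p i j (A (x + i) (y + j) - a) t"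
proof -
  let ?q = "2 ^ (e - c) :: nat" and ?W = "width e r"
  let ?I = "i div 2 ^ c" and ?J = "j div 2 ^ c"
  define k where "k = ?I * ?q + ?J"
  define sub where "sub = (\<lambda>k. if rng A c (x + k div ?q * 2 ^ c) (y + k mod ?q * 2 ^ c) = 0 then []
      else S (x + k div ?q * 2 ^ c) (y + k mod ?q * 2 ^ c))"
  define lo where "lo = (\<lambda>k. A (x + k div ?q * 2 ^ c) (y + k mod ?q * 2 ^ c) - a)"
  define x' where "x' = x + ?I * 2 ^ c"
  define y' where "y' = y + ?J * 2 ^ c"
  have at': "occurs_at D p (node ?W (2 ^ c) ?q lo sub)"
    using at by (simp add: block_node_def lo_def sub_def)
  have ce: "(2::nat) ^ e = ?q * 2 ^ c" using c by (simp flip: power_add)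
  have IJ: "?I < ?q" "?J < ?q" using ij unfolding ce by (auto intro: less_mult_imp_div_less)
  have k: "k div ?q = ?I" "k mod ?q = ?J" using IJ by (auto simp: k_def)
  have kq: "k < ?q * ?q" using IJ k by (metis div_less_iff_less_mult gr_zeroI less_nat_zero_code)
  have lok: "lo k = A x' y' - a" by (simp add: lo_def k x'_def y'_def)
  have subk: "sub k = (if rng A c x' y' = 0 then [] else S x' y')"
    by (simp add: sub_def k x'_def y'_def)
  have xi: "x' + i mod 2 ^ c = x + i" "y' + j mod 2 ^ c = y + j"
    unfolding x'_def y'_def by (simp_all only: add.assoc div_mult_mod_eq)
  have x'e: "x' \<le> x + i" "y' \<le> y + j" using xi by linarith+
  have top: "A (x + i) (y + j) \<le> A (x + (2 ^ e - 1)) (y + (2 ^ e - 1))"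
    using ij by (intro mono2D[OF A]) auto
  have ax: "a \<le> A x' y'" using a(1) mono2D[OF A, of x x' y y'] by (simp add: x'_def y'_def)
  have axi: "A x' y' \<le> A (x + i) (y + j)" using x'e by (intro mono2D[OF A])
  have pw: "2 ^ (4 * e + 10) * 2 ^ floorlog 2 r = (2::nat) ^ ?W"
    by (simp add: width_def power_add)
  have eW: "(2::nat) ^ e < 2 ^ ?W" by (simp add: width_def)
  have sub_le: "length (sub l) \<le> 2 ^ (4 * c + 8) * r" if "l < ?q * ?q" for l
  proof -
    have "l div ?q < ?q" "l mod ?q < ?q" using that by (auto intro: less_mult_imp_div_less)
    then have "rng A c (x + l div ?q * 2 ^ c) (y + l mod ?q * 2 ^ c) \<le> rng A e x y"
      using A c by (intro rng_subblock_le)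
    also have "\<dots> \<le> r" using a unfolding rng_def by linarith
    finally show ?thesis
      using small[of "x + l div ?q * 2 ^ c" "y + l mod ?q * 2 ^ c"]
      by (auto simp: sub_def intro: order_trans mult_left_mono)
  qed
  \<comment> \<open>There are \<open>2 ^ (2 * (e - c))\<close> children of at most
    \<open>2 ^ (4 * c + 8) * r\<close> bits; as \<open>c \<le> e\<close>, the exponents add up to at
    most \<open>4 * e + 8\<close>. The two further bits of the width leave room for the plus
    one.\<close>
  have fits: "(\<Sum>l<?q * ?q. length (sub l)) + 1 < 2 ^ ?W"
  proof -
    have "(\<Sum>l<?q * ?q. length (sub l)) \<le> (?q * ?q) * (2 ^ (4 * c + 8) * r)"
      using sum_bounded_above[of "{..<?q * ?q}" "\<lambda>l. length (sub l)"] sub_le by simp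
    also have "\<dots> = 2 ^ (2 * (e - c) + (4 * c + 8)) * r"
      by (simp add: power_add[of _ "2 * (e - c)"] two_power_square mult.assoc)
    also have "\<dots> \<le> 2 ^ (4 * e + 8) * r"
      using c by (intro mult_right_mono power_increasing) auto
    also have "\<dots> \<le> 2 ^ (4 * e + 8) * 2 ^ floorlog 2 r"
      using less_two_power_floorlog[of r] by (intro mult_left_mono) auto
    finally have "(\<Sum>l<?q * ?q. length (sub l)) \<le> 2 ^ (4 * e + 8) * 2 ^ floorlog 2 r" .
    moreover have "2 ^ (4 * e + 8) * 2 ^ floorlog 2 r + 1 < (2 ^ (4 * e + 10) * 2 ^ floorlog 2 r :: nat)"
    proof -
      have "1 \<le> (2::nat) ^ (4 * e + 8) * 2 ^ floorlog 2 r" by simp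
      moreover have "2 ^ (4 * e + 10) * 2 ^ floorlog 2 r = (4 * (2 ^ (4 * e + 8) * 2 ^ floorlog 2 r) :: nat)"
        by (simp add: power_add)
      ultimately show ?thesis by linarith
    qed
    ultimately show ?thesis unfolding pw by linarith
  qed
  have "\<exists>t\<le>T + 1. lookup D w G Z p i j (lo k + (A (x + i) (y + j) - A x' y')) t"
    unfolding k_def
  proof (rule lookup_node[OF at' _ w])
    show "2 ^ c < (2::nat) ^ ?W" "?q < 2 ^ ?W"
      using c eW by (auto intro: le_less_trans[OF power_increasing[of _ e]])
    show "lo (?I * ?q + ?J) < 2 ^ ?W"
    proof -
      have "A x' y' - a \<le> r" using axi top a(2) by linarith
      also have "r < 2 ^ floorlog 2 r" by (rule less_two_power_floorlog)
      also have "\<dots> \<le> 2 ^ ?W" by (simp add: width_def)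
      finally show ?thesis using lok by (simp add: k_def)
    qed
    show "A (x + i) (y + j) - A x' y' = 0" if "sub (?I * ?q + ?J) = []"
    proof -
      have "rng A c x' y' = 0" using that small[of x' y'] subk by (auto simp: k_def split: if_splits)
      then show ?thesis using block_diff_le_rng[OF A, of "i mod 2 ^ c" c "j mod 2 ^ c" x' y'] xi by simp
    qed
    show "\<exists>t\<le>T. lookup D w G Z (p + (4 * ?W + 1) + ?q * ?q * (2 * ?W)
       + (\<Sum>l<?I * ?q + ?J. length (sub l))) (i mod 2 ^ c) (j mod 2 ^ c) (A (x + i) (y + j) - A x' y') t"
      if ne: "sub (?I * ?q + ?J) \<noteq> []"
    proof -
      have r: "rng A c x' y' \<noteq> 0" "sub k = S x' y'" using ne subk by (auto simp: k_def split: if_splits)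
      have "occurs_at D (p + (4 * ?W + 1) + ?q * ?q * (2 * ?W) + (\<Sum>l<k. length (sub l))) (S x' y')"
        using occurs_at_node_sub[OF at' kq] r by simp
      from rec[OF IJ, folded x'_def y'_def, OF r(1) _ _ this, of "i mod 2 ^ c" "j mod 2 ^ c"]
      show ?thesis by (simp add: xi k_def)
    qed
  qed (use IJ fits in \<open>auto simp: width_def\<close>)
  then show ?thesis using lok ax axi by (simp add: add_diff_inverse_nat)
qed

lemma width_mono: "e \<le> e' \<Longrightarrow> r \<le> r' \<Longrightarrow> width e r \<le> width e' r'"
  unfolding width_def by (intro add_mono mult_left_mono floorlog_mono) auto

lemma floorlog_le_self: "floorlog 2 r \<le> r"
proof (cases "r = 0")
  case False
  then have "2 ^ (floorlog 2 r - 1) \<le> r" using floorlog_bounds[of r 2] by auto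
  then show ?thesis using less_exp[of "floorlog 2 r - 1"] by linarith
qed (simp add: floorlog_def)

text \<open>The logarithm of the range is given away for the range itself: the bound becomes linear
  in \<open>r\<close>, the quantity whose sum over the blocks is controlled.\<close>

lemma width_le_mult:
  assumes "0 < r"
  shows "width e r \<le> (4 * e + 11) * r"
proof -
  have "width e r \<le> (4 * e + 10) * 1 + r" using floorlog_le_self[of r] by (simp add: width_def)
  also have "\<dots> \<le> (4 * e + 10) * r + r" using assms by (intro add_mono mult_left_mono) auto
  finally show ?thesis by (simp add: algebra_simps)
qed

lemma node_own_le:
  fixes q W :: nat
  assumes "0 < q" "0 < W"
  shows "4 * W + 1 + q * q * (2 * W) \<le> 7 * (q * q * W)"
proof -
  have "1 * W \<le> q * q * W" using assms by (intro mult_right_mono) (simp_all add: Suc_leI)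
  then show ?thesis using assms by linarith
qed

text \<open>A crude bound that serves to fix the offset widths; the actual space is counted level by
  level later. The budget \<open>256 * 2 ^ (4 * e) * r\<close> splits into 64 parts for the
  children, where \<open>c < e\<close> saves a factor of 4, and 192 parts for the node
  itself.\<close>

lemma length_block_node_le:
  assumes A: "mono2 A" and c: "c < e" and r: "0 < r" "rng A e x y \<le> r"
    and small: "\<And>x y. rng A c x y \<noteq> 0 \<Longrightarrow> length (S x y) \<le> 2 ^ (4 * c + 8) * rng A c x y"
  shows "length (block_node A e c r a x y S) \<le> 2 ^ (4 * e + 8) * r"
proof -
  let ?q = "2 ^ (e - c) :: nat" and ?W = "width e r"
  have "(\<Sum>I<?q. \<Sum>J<?q. if rng A c (x + I * 2 ^ c) (y + J * 2 ^ c) = 0 then 0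
        else length (S (x + I * 2 ^ c) (y + J * 2 ^ c))) \<le> (\<Sum>I<?q. \<Sum>J<?q. 2 ^ (4 * c + 8) * r)"
  proof (intro sum_mono)
    fix I J assume "I \<in> {..<?q}" "J \<in> {..<?q}"
    then have "rng A c (x + I * 2 ^ c) (y + J * 2 ^ c) \<le> rng A e x y"
      using A c by (intro rng_subblock_le) auto
    then show "(if rng A c (x + I * 2 ^ c) (y + J * 2 ^ c) = 0 then 0
        else length (S (x + I * 2 ^ c) (y + J * 2 ^ c))) \<le> 2 ^ (4 * c + 8) * r"
      using small[of "x + I * 2 ^ c" "y + J * 2 ^ c"] r
      by (auto intro: order_trans mult_left_mono)
  qed
  also have "\<dots> = 2 ^ (2 * (e - c) + (4 * c + 8)) * r"
    by (simp add: power_add[of _ "2 * (e - c)"] two_power_square mult.assoc)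
  also have "\<dots> \<le> 2 ^ (4 * e + 6) * r"
    using c by (intro mult_right_mono power_increasing) auto
  finally have 1: "(\<Sum>I<?q. \<Sum>J<?q. if rng A c (x + I * 2 ^ c) (y + J * 2 ^ c) = 0 then 0
        else length (S (x + I * 2 ^ c) (y + J * 2 ^ c))) \<le> 2 ^ (4 * e + 6) * r" .
  have W: "?W \<le> (4 * e + 11) * r" by (rule width_le_mult[OF r(1)])
  have q: "?q * ?q \<le> 2 ^ e * 2 ^ e" by (intro mult_mono power_increasing) auto
  have "4 * ?W + 1 + ?q * ?q * (2 * ?W) \<le> 7 * (?q * ?q * ?W)"
    by (rule node_own_le) (auto simp: width_def)
  also have "\<dots> \<le> 7 * ((2 ^ e * 2 ^ e) * ((4 * e + 11) * r))"
    using W q by (intro mult_left_mono mult_mono) auto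
  also have "\<dots> = (2 ^ e * 2 ^ e) * r * (28 * e + 77)" by (simp add: algebra_simps)
  also have "\<dots> \<le> (2 ^ e * 2 ^ e) * r * (192 * (2 ^ e * 2 ^ e))"
  proof (intro mult_left_mono)
    show "28 * e + 77 \<le> 192 * (2 ^ e * 2 ^ e)" by (induction e) auto
  qed auto
  also have "\<dots> = 192 * 2 ^ (4 * e) * r" by (simp add: power_mult power4_eq_xxxx power_mult_distrib[symmetric] mult_ac)
  finally have 2: "4 * ?W + 1 + ?q * ?q * (2 * ?W) \<le> 192 * 2 ^ (4 * e) * r" .
  show ?thesis unfolding length_block_node using 1 2 by (simp add: power_add)
qed

text \<open>The cap \<open>\<beta>\<close> limits the length of table codes, and the header width of
  a reference is the code length itself. With \<open>\<beta> = 0\<close> no block of nonzero range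
  refers to the table. An explicit bottom block is a node whose subblocks are single entries, hence
  constant and childless.\<close>

fun encode :: "(nat \<Rightarrow> nat \<Rightarrow> nat) \<Rightarrow> nat \<Rightarrow> ((nat \<Rightarrow> nat \<Rightarrow> nat) \<Rightarrow> nat) \<Rightarrow> nat \<Rightarrow> nat \<Rightarrow> nat \<Rightarrow> nat
    \<Rightarrow> bool list" where
  "encode A \<beta> code 0 e x y =
    (if 2 * 2 ^ e * rng A e x y \<le> \<beta>
     then header (2 * 2 ^ e * rng A e x y) 0 (code (\<lambda>i j. A (x + i) (y + j) - A x y))
     else block_node A e 0 (rng A e x y) (A x y) x y (\<lambda>_ _. []))"
| "encode A \<beta> code (Suc L) e x y =
    block_node A e (3 * e div 4) (rng A e x y) (A x y) x y (encode A \<beta> code L (3 * e div 4))"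

lemma length_encode_pos: "0 < length (encode A \<beta> code L e x y)"
  by (cases L) (simp_all add: length_block_node del: length_greater_0_conv)

lemma rng_nonzero_exponent: "rng A e x y \<noteq> 0 \<Longrightarrow> 0 < e"
  by (cases e) auto

lemma length_encode_le:
  assumes "mono2 A" "rng A e x y \<noteq> 0"
  shows "length (encode A \<beta> code L e x y) \<le> 2 ^ (4 * e + 8) * rng A e x y"
  using assms(2)
proof (induction L arbitrary: e x y)
  case 0
  show ?case
  proof (cases "2 * 2 ^ e * rng A e x y \<le> \<beta>")
    case True
    have "1 * 1 \<le> (2::nat) ^ e * rng A e x y"
      using 0 by (intro mult_mono) (auto simp: Suc_leI)
    moreover have "(2::nat) ^ e * rng A e x y \<le> 2 ^ (4 * e) * rng A e x y"
      by (intro mult_right_mono power_increasing) auto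
    moreover have "2 ^ (4 * e + 8) * rng A e x y = 256 * (2 ^ (4 * e) * rng A e x y)"
      by (simp add: power_add)
    moreover have "length (encode A \<beta> code 0 e x y) = 8 * (2 ^ e * rng A e x y) + 1"
      using True by simp
    ultimately show ?thesis by linarith
  next
    case False
    then show ?thesis
      using length_block_node_le[OF assms(1) rng_nonzero_exponent[OF 0], of "rng A e x y" x y "\<lambda>_ _. []"] 0
      by simp
  qed
next
  case (Suc L)
  have "0 < e" using Suc.prems by (rule rng_nonzero_exponent)
  then show ?case
    unfolding encode.simps using Suc
    by (intro length_block_node_le[OF assms(1)]) auto
qed

text \<open>The table is abstracted into the hypothesis \<open>tab\<close>, so the trie can be
  treated before the table is built. Beyond the \<open>L\<close> descents a query needs at most two
  rounds: the jump into the table and the reading of the record.\<close>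

lemma lookup_encode:
  assumes A: "mono2 A" and Z: "0 < Z" and \<beta>: "2 * \<beta> + 1 \<le> w"
    and tab: "\<And>B r. mono2 B \<Longrightarrow> B (2 ^ f - 1) (2 ^ f - 1) = r \<Longrightarrow> 0 < r \<Longrightarrow> 2 * 2 ^ f * r \<le> \<beta> \<Longrightarrow>
      code B < 2 ^ (2 * 2 ^ f * r) \<and> (2 ^ (2 * 2 ^ f * r) + code B) * Z + G \<le> length D \<and>
      (\<forall>i<2 ^ f. \<forall>j<2 ^ f.
        \<exists>t\<le>1. lookup D w G Z (G + (2 ^ (2 * 2 ^ f * r) + code B) * Z) i j (B i j) t)"
    and "rng A e x y \<noteq> 0" "occurs_at D p (encode A \<beta> code L e x y)" "i < 2 ^ e" "j < 2 ^ e"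
    and "2 * width e (rng A e x y) + 1 \<le> w" and "f = ((\<lambda>e. 3 * e div 4) ^^ L) e"
  shows "\<exists>t\<le>L + 2. lookup D w G Z p i j (A (x + i) (y + j) - A x y) t"
  using assms(5-)
proof (induction L arbitrary: e x y p i j)
  case 0
  let ?r = "rng A e x y"
  have f: "f = e" using 0 by simp
  show ?case
  proof (cases "2 * 2 ^ e * ?r \<le> \<beta>")
    case True
    \<comment> \<open>Subtracting the corner makes translates of one shape equal, so that a single
      record serves all of them.\<close>
    define B where "B = (\<lambda>i j. A (x + i) (y + j) - A x y)"
    let ?V = "2 * 2 ^ e * ?r"
    have B: "mono2 B" unfolding mono2_def B_def
      by (intro allI impI diff_le_mono mono2D[OF A]) auto
    have "B (2 ^ f - 1) (2 ^ f - 1) = ?r" by (simp add: B_def rng_def f)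
    from tab[OF B this] 0 True have t: "code B < 2 ^ ?V" "(2 ^ ?V + code B) * Z + G \<le> length D"
      "\<exists>t\<le>1. lookup D w G Z (G + (2 ^ ?V + code B) * Z) i j (B i j) t"
      by (auto simp: f)
    then obtain t where "t \<le> 1" "lookup D w G Z (G + (2 ^ ?V + code B) * Z) i j (B i j) t" by blast
    moreover have "occurs_at D p (header ?V 0 (code B))" using 0 True by (simp add: B_def)
    ultimately have "lookup D w G Z p i j (B i j) (t + 1)"
      using t Z True \<beta> 0 by (intro lookup.table[where W = ?V and code = "code B"]) auto
    then show ?thesis using \<open>t \<le> 1\<close> by (intro exI[of _ "t + 1"]) (auto simp: B_def)
  next
    case False
    then have at: "occurs_at D p (block_node A e 0 ?r (A x y) x y (\<lambda>_ _. []))" using 0(2) by simp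
    have "\<exists>t\<le>0 + 1. lookup D w G Z p i j (A (x + i) (y + j) - A x y) t"
      by (rule lookup_block_node[OF A at _ 0(3,4) _ _ 0(5)]) (simp_all, simp add: rng_def)
    then show ?thesis by (auto intro: le_trans)
  qed
next
  case (Suc L)
  let ?c = "3 * e div 4"
  have "\<exists>t\<le>(L + 2) + 1. lookup D w G Z p i j (A (x + i) (y + j) - A x y) t"
  proof (rule lookup_block_node[OF A Suc.prems(2)[unfolded encode.simps] _ Suc.prems(3,4) _ _ Suc.prems(5)])
    show "0 < length (encode A \<beta> code L ?c x y)
        \<and> length (encode A \<beta> code L ?c x y) \<le> 2 ^ (4 * ?c + 8) * rng A ?c x y"
      if "rng A ?c x y \<noteq> 0" for x y
      using length_encode_pos length_encode_le[OF A that] by blast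
    fix I J p' i' j' :: nat
    let ?x = "x + I * 2 ^ ?c" and ?y = "y + J * 2 ^ ?c"
    assume IJ: "I < 2 ^ (e - ?c)" "J < 2 ^ (e - ?c)" and r: "rng A ?c ?x ?y \<noteq> 0"
      and ij: "i' < 2 ^ ?c" "j' < 2 ^ ?c" and at: "occurs_at D p' (encode A \<beta> code L ?c ?x ?y)"
    have "rng A ?c ?x ?y \<le> rng A e x y" using IJ by (intro rng_subblock_le[OF A]) auto
    then have "width ?c (rng A ?c ?x ?y) \<le> width e (rng A e x y)" by (intro width_mono) auto
    then have "2 * width ?c (rng A ?c ?x ?y) + 1 \<le> w" using Suc.prems(5) by linarith
    moreover have "f = ((\<lambda>e. 3 * e div 4) ^^ L) ?c"
      using Suc.prems(6) by (simp only: funpow_Suc_right comp_apply)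
    ultimately show "\<exists>t\<le>L + 2. lookup D w G Z p' i' j' (A (?x + i') (?y + j') - A ?x ?y) t"
      by (rule Suc.IH[OF r at ij])
  qed (auto simp: rng_def)
  then show ?case by simp
qed

section \<open>Sharing small blocks and counting bits\<close>

text \<open>Listing the image in decreasing order recovers the function.\<close>

lemma strict_antimono_image_eq:
  fixes f g :: "nat \<Rightarrow> nat"
  assumes "\<And>i i'. i < i' \<Longrightarrow> i' < b \<Longrightarrow> f i' < f i" "\<And>i i'. i < i' \<Longrightarrow> i' < b \<Longrightarrow> g i' < g i"
    and "f ` {..<b} = g ` {..<b}" "i < b"
  shows "f i = g i"
proof -
  have "sorted_wrt (<) (rev (map f [0..<b]))" "sorted_wrt (<) (rev (map g [0..<b]))"
    unfolding sorted_wrt_rev using assms(1,2) by (auto simp: sorted_wrt_iff_nth_less)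
  moreover have "set (rev (map f [0..<b])) = set (rev (map g [0..<b]))"
    using assms(3) by (simp add: atLeast0LessThan)
  ultimately have "rev (map f [0..<b]) = rev (map g [0..<b])"
    by (intro strict_sorted_equal) auto
  then show ?thesis using assms(4) by simp
qed

text \<open>A downward closed set of indices is an initial segment, so its cardinality decides
  membership.\<close>

lemma less_card_iff:
  fixes b :: nat
  assumes "j < b" "\<And>j j'. j \<le> j' \<Longrightarrow> P j' \<Longrightarrow> P j"
  shows "j < card {j. j < b \<and> P j} \<longleftrightarrow> P j"
proof
  assume "P j"
  then have "{..j} \<subseteq> {j. j < b \<and> P j}" using assms by auto
  from card_mono[OF _ this] show "j < card {j. j < b \<and> P j}" by simp
next
  assume j: "j < card {j. j < b \<and> P j}"
  show "P j"
  proof (rule ccontr)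
    assume "\<not> P j"
    then have "{j. j < b \<and> P j} \<subseteq> {..<j}" using assms(2) by (auto simp: not_le[symmetric])
    from card_mono[OF _ this] show False using j by simp
  qed
qed

text \<open>A monotone block is the family of its \<open>r\<close> level paths. The path of level \<open>v\<close> has at row \<open>i\<close>
  the height \<open>card {j. j < b \<and> B i j \<le> v}\<close>, which decreases in \<open>i\<close>; adding \<open>b - 1 - i\<close> makes the
  heights strictly decreasing, so that the path is determined by a subset of \<open>{..<2 * b}\<close>.\<close>

lemma monotone_block_code:
  assumes "0 < b"
  obtains code :: "(nat \<Rightarrow> nat \<Rightarrow> nat) \<Rightarrow> nat" where
    "\<And>B r. mono2 B \<Longrightarrow> B (b - 1) (b - 1) = r \<Longrightarrow> code B < 2 ^ (2 * b * r)"
    "\<And>B B' i j. mono2 B \<Longrightarrow> mono2 B' \<Longrightarrow> B (b - 1) (b - 1) = B' (b - 1) (b - 1) \<Longrightarrow>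
      code B = code B' \<Longrightarrow> i < b \<Longrightarrow> j < b \<Longrightarrow> B i j = B' i j"
proof -
  define ht where "ht = (\<lambda>B i v. card {j. j < b \<and> (B :: nat \<Rightarrow> nat \<Rightarrow> nat) i j \<le> v} + (b - 1 - i))"
  define sig where "sig = (\<lambda>B. SIGMA v:{..<B (b - 1) (b - 1)}. (\<lambda>i. ht B i v) ` {..<b})"
  have "\<exists>g. bij_betw g (Pow ({..<r} \<times> {..<2 * b})) {0..<card (Pow ({..<r} \<times> {..<2 * b}))}" for r :: nat
    by (rule ex_bij_betw_finite_nat) auto
  then obtain g where g: "\<And>r :: nat. bij_betw (g r) (Pow ({..<r} \<times> {..<2 * b}))
      {0..<card (Pow ({..<r} \<times> {..<2 * b}))}" by metis
  have card: "card (Pow ({..<r} \<times> {..<2 * b})) = 2 ^ (2 * b * r)" for r :: nat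
    by (simp add: card_Pow mult.commute)
  have sub: "sig B \<in> Pow ({..<B (b - 1) (b - 1)} \<times> {..<2 * b})" for B
  proof -
    have "ht B i v < 2 * b" if "i < b" for i v
    proof -
      have "card {j. j < b \<and> B i j \<le> v} \<le> card {..<b}" by (intro card_mono) auto
      then show ?thesis using that by (simp add: ht_def)
    qed
    then show ?thesis by (auto simp: sig_def)
  qed
  define code where "code = (\<lambda>B. g (B (b - 1) (b - 1)) (sig B))"
  have "code B < 2 ^ (2 * b * r)" if "mono2 B" "B (b - 1) (b - 1) = r" for B r
    using bij_betwE[OF g, of r] sub[of B] that card[of r] by (force simp: code_def)
  moreover have "B i j = B' i j" if B: "mono2 B" "mono2 B'" and r: "B (b - 1) (b - 1) = B' (b - 1) (b - 1)"
    and c: "code B = code B'" and ij: "i < b" "j < b" for B B' i j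
  proof -
    have inj: "inj_on (g (B (b - 1) (b - 1))) (Pow ({..<B (b - 1) (b - 1)} \<times> {..<2 * b}))"
      using g by (rule bij_betw_imp_inj_on)
    have sig: "sig B = sig B'"
      by (rule inj_onD[OF inj]) (use c r sub[of B] sub[of B'] in \<open>simp_all add: code_def\<close>)
    have anti: "ht B i' v < ht B i v" if "mono2 B" "i < i'" "i' < b" for B i i' v
    proof -
      have "card {j. j < b \<and> B i' j \<le> v} \<le> card {j. j < b \<and> B i j \<le> v}"
        using mono2D[OF that(1), of i i'] that(2)
        by (intro card_mono) (auto intro: order_trans)
      then show ?thesis using that by (simp add: ht_def)
    qed
    \<comment> \<open>Levels from the top value upwards contain the whole block, so
      \<open>sig\<close> omits them.\<close>
    have le: "B i j \<le> v \<longleftrightarrow> B' i j \<le> v" if "v < B (b - 1) (b - 1)" for v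
    proof -
      have "sig B `` {v} = sig B' `` {v}" using sig by simp
      then have "(\<lambda>i. ht B i v) ` {..<b} = (\<lambda>i. ht B' i v) ` {..<b}"
        using that r by (auto simp: sig_def)
      from strict_antimono_image_eq[OF anti[OF B(1)] anti[OF B(2)] this ij(1)]
      have "card {j. j < b \<and> B i j \<le> v} = card {j. j < b \<and> B' i j \<le> v}"
        by (simp add: ht_def)
      moreover have pt: "j < card {j. j < b \<and> C i j \<le> v} \<longleftrightarrow> C i j \<le> v" if "mono2 C" for C
        by (rule less_card_iff[OF ij(2)]) (auto intro: order_trans mono2D[OF that])
      ultimately show ?thesis using pt[OF B(1)] pt[OF B(2)] by metis
    qed
    have b: "i \<le> b - 1" "j \<le> b - 1" using ij by linarith+
    have top: "B i j \<le> B (b - 1) (b - 1)" "B' i j \<le> B (b - 1) (b - 1)"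
      using mono2D[OF B(1) b] mono2D[OF B(2) b] r by simp_all
    show ?thesis
    \<comment> \<open>If the two entries differ, the smaller one is a level below the common top
      value, and this level separates them.\<close>
    proof (rule antisym; rule ccontr)
      assume "\<not> B i j \<le> B' i j"
      then show False using le[of "B' i j"] top by simp
    next
      assume "\<not> B' i j \<le> B i j"
      then show False using le[of "B i j"] top by simp
    qed
  qed
  ultimately show ?thesis by (rule that)
qed

text \<open>The leading bit of the sum stands at position \<open>a\<close>, so a table index reveals
  the length of its code.\<close>

lemma two_power_add_unique:
  fixes c c' :: nat
  assumes "2 ^ a + c = 2 ^ a' + c'" "c < 2 ^ a" "c' < 2 ^ a'"
  shows "a = a'"
proof -
  have "\<not> a < a'" if "2 ^ a + c = 2 ^ a' + c'" "c < 2 ^ a" for a a' c c' :: nat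
  proof
    assume "a < a'"
    then have "(2::nat) ^ (a + 1) \<le> 2 ^ a'" by (intro power_increasing) auto
    then show False using that by simp
  qed
  from this[of a c a' c'] this[of a' c' a c] show ?thesis using assms by linarith
qed

lemma monotone_block_table:
  obtains code :: "(nat \<Rightarrow> nat \<Rightarrow> nat) \<Rightarrow> nat" and tbl :: "nat \<Rightarrow> nat \<Rightarrow> nat \<Rightarrow> nat" where
    "\<And>B r. mono2 B \<Longrightarrow> B (2 ^ f - 1) (2 ^ f - 1) = r \<Longrightarrow> code B < 2 ^ (2 * 2 ^ f * r)"
    "\<And>k. mono2 (tbl k)" "\<And>k. tbl k (2 ^ f - 1) (2 ^ f - 1) \<le> \<beta>"
    "\<And>B r i j. mono2 B \<Longrightarrow> B (2 ^ f - 1) (2 ^ f - 1) = r \<Longrightarrow> 2 * 2 ^ f * r \<le> \<beta> \<Longrightarrow>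
      i < 2 ^ f \<Longrightarrow> j < 2 ^ f \<Longrightarrow> tbl (2 ^ (2 * 2 ^ f * r) + code B) i j = B i j"
proof -
  obtain code :: "(nat \<Rightarrow> nat \<Rightarrow> nat) \<Rightarrow> nat" where code:
    "\<And>B r. mono2 B \<Longrightarrow> B (2 ^ f - 1) (2 ^ f - 1) = r \<Longrightarrow> code B < 2 ^ (2 * 2 ^ f * r)"
    "\<And>B B' i j. mono2 B \<Longrightarrow> mono2 B' \<Longrightarrow> B (2 ^ f - 1) (2 ^ f - 1) = B' (2 ^ f - 1) (2 ^ f - 1) \<Longrightarrow>
      code B = code B' \<Longrightarrow> i < 2 ^ f \<Longrightarrow> j < 2 ^ f \<Longrightarrow> B i j = B' i j"
    using monotone_block_code[of "2 ^ f"] by auto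
  define ok where "ok = (\<lambda>k B. mono2 B \<and> 2 * 2 ^ f * B (2 ^ f - 1) (2 ^ f - 1) \<le> \<beta> \<and>
    k = 2 ^ (2 * 2 ^ f * B (2 ^ f - 1) (2 ^ f - 1)) + code B)"
  \<comment> \<open>An index that is no code gets the zero block, so that every record is well
    formed and of the common size.\<close>
  define tbl where "tbl = (\<lambda>k. if Ex (ok k) then Eps (ok k) else (\<lambda>_ _. 0))"
  have tbl: "ok k (tbl k)" if "ok k B" for k B
    using that someI[of "ok k"] by (auto simp: tbl_def)
  have 1: "mono2 (tbl k) \<and> tbl k (2 ^ f - 1) (2 ^ f - 1) \<le> \<beta>" for k
  proof (cases "Ex (ok k)")
    case True
    then have "ok k (tbl k)" using tbl by blast
    moreover have "tbl k (2 ^ f - 1) (2 ^ f - 1) \<le> 2 * 2 ^ f * tbl k (2 ^ f - 1) (2 ^ f - 1)" by simp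
    ultimately show ?thesis unfolding ok_def by linarith
  qed (auto simp: tbl_def mono2_def)
  have 2: "tbl (2 ^ (2 * 2 ^ f * r) + code B) i j = B i j"
    if B: "mono2 B" "B (2 ^ f - 1) (2 ^ f - 1) = r" "2 * 2 ^ f * r \<le> \<beta>" and ij: "i < 2 ^ f" "j < 2 ^ f"
    for B r i j
  proof -
    define B' where "B' = tbl (2 ^ (2 * 2 ^ f * r) + code B)"
    have "ok (2 ^ (2 * 2 ^ f * r) + code B) B" using B by (simp add: ok_def)
    from tbl[OF this, folded B'_def] have B': "mono2 B'"
      and eq: "2 ^ (2 * 2 ^ f * r) + code B = 2 ^ (2 * 2 ^ f * B' (2 ^ f - 1) (2 ^ f - 1)) + code B'"
      by (simp_all add: ok_def)
    have "2 * 2 ^ f * r = 2 * 2 ^ f * B' (2 ^ f - 1) (2 ^ f - 1)"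
      using eq code(1)[OF B(1,2)] code(1)[OF B' refl] by (rule two_power_add_unique)
    then have r: "r = B' (2 ^ f - 1) (2 ^ f - 1)" by simp
    have "code B' = code B" using eq unfolding r[symmetric] by simp
    from code(2)[OF B' B(1) trans[OF r[symmetric] B(2)[symmetric]] this ij]
    show ?thesis by (simp only: B'_def)
  qed
  show ?thesis by (rule that[of code tbl, OF code(1) _ _ 2]) (simp_all only: 1)
qed

section \<open>Total space of the levels of the trie\<close>

lemma sum_shift_le:
  fixes h :: "nat \<Rightarrow> nat"
  assumes "h Q \<le> m"
  shows "(\<Sum>k<Q. h (Suc k)) \<le> (\<Sum>k<Q. h k) + m"
proof -
  have "h 0 + (\<Sum>k<Q. h (Suc k)) = (\<Sum>k<Q. h k) + h Q"
    using sum.lessThan_Suc_shift[of h Q] by simp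
  then show ?thesis using assms by linarith
qed

text \<open>The far corner of a block is at most the near corner of its diagonal successor, so the
  sum telescopes along the diagonals. The excess lies on a boundary of \<open>2 * Q\<close> corners,
  each at most \<open>m\<close>.\<close>

lemma sum_rng_le:
  assumes A: "mono2 A" and m: "\<And>i j. A i j \<le> m"
  shows "(\<Sum>I<Q. \<Sum>J<Q. rng A e (I * 2 ^ e) (J * 2 ^ e)) \<le> 2 * Q * m"
proof -
  define h where "h = (\<lambda>I J. A (I * 2 ^ e) (J * 2 ^ e))"
  have hm: "h I J \<le> m" for I J using m by (simp add: h_def)
  have "rng A e (I * 2 ^ e) (J * 2 ^ e) + h I J \<le> h (Suc I) (Suc J)" for I J
  proof -
    have "A (I * 2 ^ e + (2 ^ e - 1)) (J * 2 ^ e + (2 ^ e - 1)) \<le> h (Suc I) (Suc J)"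
      unfolding h_def by (intro mono2D[OF A]) auto
    moreover have "h I J \<le> A (I * 2 ^ e + (2 ^ e - 1)) (J * 2 ^ e + (2 ^ e - 1))"
      unfolding h_def by (intro mono2D[OF A] le_add1)
    ultimately show ?thesis by (simp add: rng_def h_def)
  qed
  then have "(\<Sum>I<Q. \<Sum>J<Q. rng A e (I * 2 ^ e) (J * 2 ^ e)) + (\<Sum>I<Q. \<Sum>J<Q. h I J)
      \<le> (\<Sum>I<Q. \<Sum>J<Q. h (Suc I) (Suc J))"
    unfolding sum.distrib[symmetric] by (intro sum_mono)
  also have "\<dots> \<le> (\<Sum>I<Q. (\<Sum>J<Q. h (Suc I) J) + m)"
    by (intro sum_mono sum_shift_le hm)
  also have "\<dots> = (\<Sum>J<Q. \<Sum>I<Q. h (Suc I) J) + Q * m"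
    by (subst sum.swap) (simp add: sum.distrib)
  also have "\<dots> \<le> (\<Sum>J<Q. (\<Sum>I<Q. h I J) + m) + Q * m"
    by (intro add_mono sum_mono sum_shift_le[where h = "\<lambda>I. h I _"] hm order_refl)
  also have "\<dots> = (\<Sum>I<Q. \<Sum>J<Q. h I J) + 2 * Q * m"
    by (subst sum.swap) (simp add: sum.distrib)
  finally show ?thesis by simp
qed

text \<open>This is where the ratio 3/4 pays. For \<open>t\<close> equal to \<open>e / 4\<close>
  rounded up, the \<open>2 ^ (2 * t)\<close> entries of a node leave another factor
  \<open>2 ^ (2 * t)\<close>, which absorbs the width. The constant is 7 * 27 * 8, the 8 coming from
  the rounding of \<open>t\<close>.\<close>

lemma level_cost_le:
  "7 * (2 ^ (e - 3 * e div 4) * 2 ^ (e - 3 * e div 4) * ((4 * e + 11) * r)) \<le> 1512 * 2 ^ e * (r :: nat)"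
proof -
  define t where "t = e - 3 * e div 4"
  have t: "e \<le> 4 * t" "4 * t \<le> e + 3" unfolding t_def by presburger+
  have p: "16 * t + 11 \<le> 27 * (2 ^ t * 2 ^ t)" by (induction t) auto
  have "2 ^ t * 2 ^ t * (4 * e + 11) \<le> 2 ^ t * 2 ^ t * (27 * (2 ^ t * 2 ^ t))"
    using p t by (intro mult_left_mono) linarith+
  also have "\<dots> = 27 * 2 ^ (4 * t)"
    by (simp add: power_mult power4_eq_xxxx power_mult_distrib[symmetric] mult_ac)
  also have "\<dots> \<le> 27 * 2 ^ (e + 3)" using t by (intro mult_left_mono power_increasing) auto
  finally have "2 ^ t * 2 ^ t * (4 * e + 11) \<le> 216 * 2 ^ e" by (simp add: power_add)
  then have "2 ^ t * 2 ^ t * (4 * e + 11) * r \<le> 216 * 2 ^ e * r" by (rule mult_right_mono) simp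
  then show ?thesis unfolding t_def[symmetric] by (simp add: mult.assoc)
qed

lemma sum_grid_refine:
  fixes h :: "nat \<Rightarrow> nat \<Rightarrow> nat"
  shows "(\<Sum>I<a. \<Sum>J<a. \<Sum>I'<b. \<Sum>J'<b. h (I * b + I') (J * b + J')) = (\<Sum>X<a * b. \<Sum>Y<a * b. h X Y)"
proof -
  have 1: "(\<Sum>X<a * b. u X) = (\<Sum>I<a. \<Sum>I'<b. u (I * b + I'))" for u :: "nat \<Rightarrow> nat"
    using sum_div_mod[of "\<lambda>I I'. u (I * b + I')" b a] by simp
  show ?thesis unfolding 1 by (subst sum.swap[of _ "{..<b}" "{..<a}"]) simp
qed

text \<open>A level of exponent \<open>e\<close> costs at most \<open>1512 * 2 ^ e\<close> bits per
  unit of range, and its ranges sum to at most \<open>2 * 2 ^ (E - e) * m\<close>; so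
  \<open>e\<close> cancels and all levels have the same bound.\<close>

lemma sum_length_encode_le:
  assumes A: "mono2 A" and m: "\<And>i j. A i j \<le> m"
    and leaf: "\<And>x y. rng A f x y \<noteq> 0 \<Longrightarrow>
      length (encode A \<beta> code 0 f x y) \<le> F * 2 ^ f * rng A f x y"
    and "e \<le> E" "f = ((\<lambda>e. 3 * e div 4) ^^ L) e"
  shows "(\<Sum>I<2 ^ (E - e). \<Sum>J<2 ^ (E - e). if rng A e (I * 2 ^ e) (J * 2 ^ e) = 0 then 0
      else length (encode A \<beta> code L e (I * 2 ^ e) (J * 2 ^ e))) \<le> (1512 * L + F) * (2 * 2 ^ E * m)"
  using assms(4,5)
proof (induction L arbitrary: e)
  case 0
  have E: "(2::nat) ^ E = 2 ^ e * 2 ^ (E - e)" using 0 by (simp flip: power_add)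
  have "(\<Sum>I<2 ^ (E - e). \<Sum>J<2 ^ (E - e). if rng A e (I * 2 ^ e) (J * 2 ^ e) = 0 then 0
      else length (encode A \<beta> code 0 e (I * 2 ^ e) (J * 2 ^ e)))
    \<le> (\<Sum>I<2 ^ (E - e). \<Sum>J<2 ^ (E - e). F * 2 ^ e * rng A e (I * 2 ^ e) (J * 2 ^ e))"
    using leaf 0 by (intro sum_mono) (simp del: encode.simps)
  also have "\<dots> = F * 2 ^ e * (\<Sum>I<2 ^ (E - e). \<Sum>J<2 ^ (E - e). rng A e (I * 2 ^ e) (J * 2 ^ e))"
    by (simp add: sum_distrib_left)
  also have "\<dots> \<le> F * 2 ^ e * (2 * 2 ^ (E - e) * m)"
    by (intro mult_left_mono sum_rng_le[OF A m]) auto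
  finally show ?case by (simp add: E mult_ac)
next
  case (Suc L)
  let ?c = "3 * e div 4" and ?Q = "2 ^ (E - e) :: nat" and ?q = "2 ^ (e - 3 * e div 4) :: nat"
  let ?S = "encode A \<beta> code L ?c"
  define H where "H = (\<lambda>X Y. if rng A ?c (X * 2 ^ ?c) (Y * 2 ^ ?c) = 0 then 0
      else length (?S (X * 2 ^ ?c) (Y * 2 ^ ?c)))"
  have E: "(2::nat) ^ E = 2 ^ e * ?Q" using Suc.prems by (simp flip: power_add)
  have qc: "?q * 2 ^ ?c = 2 ^ e" by (simp flip: power_add)
  have co: "I * 2 ^ e + I' * 2 ^ ?c = (I * ?q + I') * 2 ^ ?c" for I I' :: nat
    by (simp add: qc[symmetric] algebra_simps)
  have Qq: "?Q * ?q = 2 ^ (E - ?c)" using Suc.prems by (simp flip: power_add)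
  have "(if rng A e (I * 2 ^ e) (J * 2 ^ e) = 0 then 0
      else length (encode A \<beta> code (Suc L) e (I * 2 ^ e) (J * 2 ^ e)))
    \<le> 1512 * 2 ^ e * rng A e (I * 2 ^ e) (J * 2 ^ e) + (\<Sum>I'<?q. \<Sum>J'<?q. H (I * ?q + I') (J * ?q + J'))"
    (is "?l \<le> _") for I J
  proof (cases "rng A e (I * 2 ^ e) (J * 2 ^ e) = 0")
    case False
    let ?r = "rng A e (I * 2 ^ e) (J * 2 ^ e)"
    have "4 * width e ?r + 1 + ?q * ?q * (2 * width e ?r) \<le> 7 * (?q * ?q * width e ?r)"
      by (rule node_own_le) (auto simp: width_def)
    also have "\<dots> \<le> 7 * (?q * ?q * ((4 * e + 11) * ?r))"
      using False by (intro mult_left_mono width_le_mult) auto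
    also have "\<dots> \<le> 1512 * 2 ^ e * ?r" by (rule level_cost_le)
    finally show ?thesis using False unfolding H_def co[symmetric]
      by (simp add: length_block_node)
  qed simp
  then have "(\<Sum>I<?Q. \<Sum>J<?Q. if rng A e (I * 2 ^ e) (J * 2 ^ e) = 0 then 0
      else length (encode A \<beta> code (Suc L) e (I * 2 ^ e) (J * 2 ^ e)))
    \<le> (\<Sum>I<?Q. \<Sum>J<?Q. 1512 * 2 ^ e * rng A e (I * 2 ^ e) (J * 2 ^ e)
        + (\<Sum>I'<?q. \<Sum>J'<?q. H (I * ?q + I') (J * ?q + J')))"
    by (intro sum_mono)
  also have "\<dots> = 1512 * 2 ^ e * (\<Sum>I<?Q. \<Sum>J<?Q. rng A e (I * 2 ^ e) (J * 2 ^ e))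
      + (\<Sum>X<2 ^ (E - ?c). \<Sum>Y<2 ^ (E - ?c). H X Y)"
    unfolding Qq[symmetric] sum_grid_refine[symmetric] by (simp add: sum.distrib sum_distrib_left)
  also have "\<dots> \<le> 1512 * 2 ^ e * (2 * ?Q * m) + (1512 * L + F) * (2 * 2 ^ E * m)"
  proof (intro add_mono mult_left_mono sum_rng_le[OF A m])
    show "(\<Sum>X<2 ^ (E - ?c). \<Sum>Y<2 ^ (E - ?c). H X Y) \<le> (1512 * L + F) * (2 * 2 ^ E * m)"
      unfolding H_def using Suc.prems
      by (intro Suc.IH) (auto simp only: funpow_Suc_right comp_apply)
  qed auto
  also have "\<dots> = (1512 * Suc L + F) * (2 * 2 ^ E * m)" by (simp add: E algebra_simps)
  finally show ?case .
qed

lemma floorlog_le_exponent: "x < 2 ^ l \<Longrightarrow> floorlog 2 x \<le> l"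
proof (cases "x = 0")
  case False
  assume "x < 2 ^ l"
  moreover have "2 ^ (floorlog 2 x - 1) \<le> x" using False floorlog_bounds[of x 2] by auto
  ultimately have "(2::nat) ^ (floorlog 2 x - 1) < 2 ^ l" by linarith
  then have "floorlog 2 x - 1 < l" by (simp add: power_strict_increasing_iff)
  then show ?thesis by simp
qed (simp add: floorlog_def)

text \<open>The common length of the table records: a node for a block of size \<open>2 ^ f\<close>
  with single entries as subblocks, wide enough for the range \<open>\<beta>\<close>.\<close>

definition grid_size :: "nat \<Rightarrow> nat \<Rightarrow> nat" where
  "grid_size f \<beta> = 4 * width f \<beta> + 1 + 2 ^ f * 2 ^ f * (2 * width f \<beta>)"

lemma grid_size_le: "grid_size f \<beta> \<le> 7 * (2 ^ f * 2 ^ f * width f \<beta>)"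
  unfolding grid_size_def by (rule node_own_le) (auto simp: width_def)

lemma iterate_step_le: "((\<lambda>e. 3 * e div 4) ^^ L) e \<le> (e :: nat)"
proof (induction L)
  case (Suc L)
  have "3 * k div 4 \<le> k" for k :: nat by presburger
  then show ?case using Suc by (auto intro: le_trans)
qed simp

lemma width_le_capacity: "e \<le> E \<Longrightarrow> r < 2 ^ E \<Longrightarrow> width e r \<le> 5 * E + 10"
  using floorlog_le_exponent[of r E] by (simp add: width_def)

text \<open>The root splits the square of size \<open>2 ^ E\<close> directly into blocks of size
  \<open>2 ^ e\<close>, so its own cost escapes the level count and is a separate summand. A table
  index is \<open>2 ^ V\<close> plus a code below \<open>2 ^ V\<close>, where
  \<open>V \<le> \<beta>\<close>; hence \<open>2 ^ (\<beta> + 1)\<close> records suffice.\<close>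

lemma trie_structure_exists:
  assumes A: "mono2 A" and m: "\<And>i j. A i j < m" "m < 2 ^ E" and e: "e < E" and \<beta>: "\<beta> \<le> E"
    and f: "f = ((\<lambda>e. 3 * e div 4) ^^ L) e" and tn: "tn = (if \<beta> = 0 then 0 else 2 ^ (\<beta> + 1))"
    and w: "20 * E + 21 \<le> w"
    and leaf: "\<And>code x y. rng A f x y \<noteq> 0 \<Longrightarrow>
      length (encode A \<beta> code 0 f x y) \<le> F * 2 ^ f * rng A f x y"
  shows "\<exists>D. length D \<le> 20 * E + 41 + 7 * (2 ^ (E - e) * 2 ^ (E - e) * (5 * E + 10))
      + (1512 * L + F) * (2 * 2 ^ E * m) + tn * grid_size f \<beta> \<and>
    (\<forall>i<2 ^ E. \<forall>j<2 ^ E. \<exists>t s'. exec w query (query_state w D i j) t s' \<and> regs s' 0 = A i j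
      \<and> t \<le> (cost body + 1) * (L + 3) + cost prologue + 2)"
proof -
  let ?W = "5 * E + 10" and ?Z = "grid_size f \<beta>" and ?q = "2 ^ (E - e) :: nat"
  obtain code :: "(nat \<Rightarrow> nat \<Rightarrow> nat) \<Rightarrow> nat" and tbl where code:
    "\<And>B r. mono2 B \<Longrightarrow> B (2 ^ f - 1) (2 ^ f - 1) = r \<Longrightarrow> code B < 2 ^ (2 * 2 ^ f * r)"
    and tbl: "\<And>k. mono2 (tbl k)" "\<And>k. tbl k (2 ^ f - 1) (2 ^ f - 1) \<le> \<beta>"
    and code_tbl: "\<And>B r i j. mono2 B \<Longrightarrow> B (2 ^ f - 1) (2 ^ f - 1) = r \<Longrightarrow> 2 * 2 ^ f * r \<le> \<beta> \<Longrightarrow>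
      i < 2 ^ f \<Longrightarrow> j < 2 ^ f \<Longrightarrow> tbl (2 ^ (2 * 2 ^ f * r) + code B) i j = B i j"
  proof (rule monotone_block_table[of f \<beta>], goal_cases)
    case (1 c t)
    show ?case by (rule 1(1)[of c t]) (rule 1(2-5); assumption)+
  qed
  define root where "root = block_node A E e m 0 0 0 (encode A \<beta> code L e)"
  define T where "T = (\<lambda>k. block_node (tbl k) f 0 \<beta> 0 0 0 (\<lambda>_ _. []))"
  define D where "D = header ?W (length root) ?Z @ root @ concat (map T [0..<tn])"
  let ?G = "4 * ?W + 1 + length root"
  have m0: "0 < m" using m(1)[of 0 0] by linarith
  have rng_m: "rng A c x y \<le> m" for c x y
    unfolding rng_def using m(1) by (meson diff_le_self le_trans less_imp_le)
  have "f \<le> e" unfolding f by (rule iterate_step_le)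
  then have fE: "f < E" using e by linarith
  have \<beta>2: "\<beta> < 2 ^ E" using \<beta> less_exp[of E] by linarith
  have wm: "width E m \<le> ?W" using m(2) by (intro width_le_capacity) auto
  have w\<beta>: "width f \<beta> \<le> ?W" using fE \<beta>2 by (intro width_le_capacity) auto
  have lenT: "length (T k) = ?Z" for k
    by (simp add: T_def length_block_node grid_size_def)
  have lenD: "length D = 4 * ?W + 1 + length root + tn * ?Z"
    unfolding D_def length_append length_concat_upt lenT by simp
  have root_le: "length root \<le> 2 ^ (4 * E + 8) * m"
    unfolding root_def by (rule length_block_node_le[OF A e m0 rng_m]) (rule length_encode_le[OF A])
  have root_less: "length root < 2 ^ (5 * E + 8)"
  proof -
    have "2 ^ (4 * E + 8) * m < 2 ^ (4 * E + 8) * 2 ^ E" using m(2) by simp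
    also have "\<dots> = (2::nat) ^ (5 * E + 8)" unfolding power_add[symmetric] by simp
    finally show ?thesis using root_le by linarith
  qed
  have Z_le: "?Z \<le> 2 ^ (3 * E + 7)"
  proof -
    have "5 * E + 10 \<le> 15 * 2 ^ E" by (induction E) auto
    then have "7 * (2 ^ f * 2 ^ f * width f \<beta>) \<le> 7 * (2 ^ E * 2 ^ E * (15 * 2 ^ E))"
      using w\<beta> fE by (intro mult_left_mono mult_mono power_increasing) auto
    also have "\<dots> = 105 * 2 ^ (3 * E)" by (simp add: power_mult[symmetric] power_add[symmetric])
    also have "\<dots> \<le> 2 ^ (3 * E + 7)" by (simp add: power_add)
    finally show ?thesis using grid_size_le[of f \<beta>] by linarith
  qed
  have tn_le: "tn \<le> 2 ^ (E + 1)" unfolding tn using \<beta> by (auto intro!: power_increasing simp del: power_Suc)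
  have D_less: "length D + 1 < 2 ^ w"
  proof -
    have "tn * ?Z \<le> 2 ^ (E + 1) * 2 ^ (3 * E + 7)" using tn_le Z_le by (intro mult_mono) auto
    also have "\<dots> = 2 ^ (4 * E + 8)" unfolding power_add[symmetric] by simp
    also have "\<dots> \<le> 2 ^ (5 * E + 8)" by (intro power_increasing) auto
    finally have "tn * ?Z \<le> 2 ^ (5 * E + 8)" .
    moreover have "20 * E + 42 \<le> 64 * 2 ^ E" by (induction E) auto
    moreover have "64 * 2 ^ E \<le> (2::nat) ^ (5 * E + 8)"
    proof -
      have "64 * 2 ^ E = (2::nat) ^ (E + 6)" by (simp add: power_add)
      also have "\<dots> \<le> 2 ^ (5 * E + 8)" by (intro power_increasing) auto
      finally show ?thesis .
    qed
    moreover have "4 * 2 ^ (5 * E + 8) \<le> (2::nat) ^ w"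
    proof -
      have "4 * 2 ^ (5 * E + 8) = (2::nat) ^ (5 * E + 10)" by (simp add: power_add)
      also have "\<dots> \<le> 2 ^ w" using w by (intro power_increasing) auto
      finally show ?thesis .
    qed
    moreover have "a + b + c + 1 < d" if "c \<le> x" "a + 1 \<le> y" "y \<le> x" "4 * x \<le> d" "b < x"
      for a b c d x y :: nat using that by linarith
    ultimately show ?thesis using root_less unfolding lenD by (simp add: algebra_simps)
  qed
  have at_D: "occurs_at D 0 (header ?W (length root) ?Z @ root @ concat (map T [0..<tn]))"
    by (simp add: occurs_at_def D_def[symmetric])
  then have at_hd: "occurs_at D 0 (header ?W (length root) ?Z)"
    and at_root: "occurs_at D (4 * ?W + 1) root"
    and at_tab: "occurs_at D ?G (concat (map T [0..<tn]))"
    unfolding occurs_at_append by simp_all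
  have at_T: "occurs_at D (?G + k * ?Z) (T k)" if "k < tn" for k
    using occurs_at_concat[OF at_tab that] by (simp add: lenT)
  have Z0: "0 < ?Z" by (simp add: grid_size_def)
  have tab: "code B < 2 ^ (2 * 2 ^ f * r) \<and> (2 ^ (2 * 2 ^ f * r) + code B) * ?Z + ?G \<le> length D \<and>
      (\<forall>i<2 ^ f. \<forall>j<2 ^ f.
        \<exists>t\<le>1. lookup D w ?G ?Z (?G + (2 ^ (2 * 2 ^ f * r) + code B) * ?Z) i j (B i j) t)"
    if B: "mono2 B" "B (2 ^ f - 1) (2 ^ f - 1) = r" "0 < r" "2 * 2 ^ f * r \<le> \<beta>" for B r
  proof (intro conjI allI impI)
    let ?V = "2 * 2 ^ f * r"
    let ?k = "2 ^ ?V + code B"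
    show c: "code B < 2 ^ ?V" by (rule code[OF B(1,2)])
    have "0 < ?V" using B(3) by simp
    then have "0 < \<beta>" using B(4) by linarith
    then have "tn = 2 * 2 ^ \<beta>" by (simp add: tn)
    moreover have "(2::nat) ^ ?V \<le> 2 ^ \<beta>" using B(4) by (rule power_increasing) simp
    ultimately have k: "?k < tn" using c by linarith
    then have "?k * ?Z \<le> tn * ?Z" by (intro mult_right_mono) auto
    then show "?k * ?Z + ?G \<le> length D" unfolding lenD by linarith
    fix i j :: nat assume ij: "i < 2 ^ f" "j < 2 ^ f"
    have "\<exists>t\<le>0 + 1. lookup D w ?G ?Z (?G + ?k * ?Z) i j (tbl ?k (0 + i) (0 + j) - 0) t"
      by (rule lookup_block_node[OF tbl(1) at_T[OF k, unfolded T_def] _ ij])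
         (use w w\<beta> tbl(2)[of ?k] in simp_all)
    then show "\<exists>t\<le>1. lookup D w ?G ?Z (?G + ?k * ?Z) i j (B i j) t"
      using code_tbl[OF B(1,2,4) ij] by simp
  qed
  have lk: "\<exists>t\<le>(L + 2) + 1. lookup D w ?G ?Z (4 * ?W + 1) i j (A (0 + i) (0 + j) - 0) t"
    if ij: "i < 2 ^ E" "j < 2 ^ E" for i j
  proof (rule lookup_block_node[OF A at_root[unfolded root_def] _ ij])
    show "A (0 + (2 ^ E - 1)) (0 + (2 ^ E - 1)) - 0 \<le> m" using m(1) by (simp add: less_imp_le)
    show "0 < length (encode A \<beta> code L e x y)
        \<and> length (encode A \<beta> code L e x y) \<le> 2 ^ (4 * e + 8) * rng A e x y"
      if "rng A e x y \<noteq> 0" for x y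
      using length_encode_pos length_encode_le[OF A that] by blast
    fix I J p' i' j' :: nat
    assume r: "rng A e (0 + I * 2 ^ e) (0 + J * 2 ^ e) \<noteq> 0" and ij: "i' < 2 ^ e" "j' < 2 ^ e"
      and at: "occurs_at D p' (encode A \<beta> code L e (0 + I * 2 ^ e) (0 + J * 2 ^ e))"
    have "width e (rng A e (0 + I * 2 ^ e) (0 + J * 2 ^ e)) \<le> width E m"
      using e rng_m by (intro width_mono) auto
    then have "2 * width e (rng A e (0 + I * 2 ^ e) (0 + J * 2 ^ e)) + 1 \<le> w"
      using wm w by linarith
    then show "\<exists>t\<le>L + 2. lookup D w ?G ?Z p' i' j' (A (0 + I * 2 ^ e + i') (0 + J * 2 ^ e + j')
        - A (0 + I * 2 ^ e) (0 + J * 2 ^ e)) t"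
      using \<beta> w f by (intro lookup_encode[OF A Z0 _ tab r at ij]) auto
  qed (use e wm w in auto)
  have WR: "length root < 2 ^ ?W" "?Z < 2 ^ ?W"
  proof -
    have "(2::nat) ^ (5 * E + 8) \<le> 2 ^ ?W" by (intro power_increasing) auto
    then show "length root < 2 ^ ?W" using root_less by linarith
    have "(2::nat) ^ (3 * E + 7) < 2 ^ ?W" by (intro power_strict_increasing) auto
    then show "?Z < 2 ^ ?W" using Z_le by linarith
  qed
  have "\<exists>t s'. exec w query (query_state w D i j) t s' \<and> regs s' 0 = A i j
      \<and> t \<le> (cost body + 1) * (L + 3) + cost prologue + 2" if ij: "i < 2 ^ E" "j < 2 ^ E" for i j
  proof -
    obtain t where t: "t \<le> (L + 2) + 1" "lookup D w ?G ?Z (4 * ?W + 1) i j (A i j) t"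
      using lk[OF ij] unfolding add_0 diff_zero by blast
    have "A i j < 2 ^ w"
    proof -
      have "(2::nat) ^ E \<le> 2 ^ w" using w by (intro power_increasing) auto
      then show ?thesis using m(1)[of i j] m(2) by linarith
    qed
    then obtain t' s' where s': "exec w query (query_state w D i j) t' s'" "regs s' 0 = A i j"
      "t' \<le> (cost body + 1) * t + cost prologue + 2"
      using exec_query[OF at_hd _ _ WR t(2) D_less] w lenD by auto
    moreover have "(cost body + 1) * t \<le> (cost body + 1) * (L + 3)"
      using t(1) by (intro mult_left_mono) auto
    ultimately show ?thesis by (meson add_le_mono1 le_trans)
  qed
  moreover have "length D \<le> 20 * E + 41 + 7 * (?q * ?q * ?W) + (1512 * L + F) * (2 * 2 ^ E * m) + tn * ?Z"
  proof -
    have "4 * width E m + 1 + ?q * ?q * (2 * width E m) \<le> 7 * (?q * ?q * width E m)"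
      by (rule node_own_le) (auto simp: width_def)
    also have "\<dots> \<le> 7 * (?q * ?q * ?W)" using wm by (intro mult_left_mono) auto
    finally have "length root \<le> 7 * (?q * ?q * ?W) + (1512 * L + F) * (2 * 2 ^ E * m)"
      using sum_length_encode_le[OF A less_imp_le[OF m(1)] leaf less_imp_le[OF e] f, of code]
      unfolding root_def length_block_node add_0 by linarith
    then show ?thesis unfolding lenD by simp
  qed
  ultimately show ?thesis by blast
qed

section \<open>Choice of the parameters\<close>

lemma leaf_length_direct:
  assumes "rng A f x y \<noteq> 0" "\<not> 2 * 2 ^ f * rng A f x y \<le> \<beta>"
  shows "length (encode A \<beta> code 0 f x y) \<le> 7 * (2 ^ f * 2 ^ f * width f (rng A f x y))"
  using assms node_own_le[of "2 ^ f" "width f (rng A f x y)"]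
  by (simp add: length_block_node width_def)

lemma leaf_length_no_table:
  assumes "rng A f x y \<noteq> 0"
  shows "length (encode A 0 code 0 f x y) \<le> 7 * 2 ^ f * (4 * f + 11) * 2 ^ f * rng A f x y"
proof -
  have "length (encode A 0 code 0 f x y) \<le> 7 * (2 ^ f * 2 ^ f * width f (rng A f x y))"
    using assms by (intro leaf_length_direct) auto
  also have "\<dots> \<le> 7 * (2 ^ f * 2 ^ f * ((4 * f + 11) * rng A f x y))"
    using assms by (intro mult_left_mono width_le_mult) auto
  finally show ?thesis by (simp add: mult_ac)
qed

text \<open>A block whose code is too long for the table has so large a range that explicit storage
  is affordable: \<open>2 ^ (5 * f) \<le> l\<close> yields \<open>2 ^ (4 * f) < 4 * r\<close>, and
  then \<open>2 ^ f\<close> times a width of order log r stays linear in \<open>r\<close>.\<close>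

lemma width_le_large_range:
  fixes f l r :: nat
  assumes "0 < r" "2 ^ (5 * f) \<le> l" "l div 2 < 2 * 2 ^ f * r"
  shows "2 ^ f * width f r \<le> 26 * r"
proof -
  define u where "u = floorlog 2 r"
  define h where "h = u div 2"
  have "u \<noteq> 0" and lo: "2 ^ (u - 1) \<le> r" and hi: "r < 2 ^ u"
    using assms(1) floorlog_bounds[of r 2] unfolding u_def by (auto simp: floorlog_def)
  have "2 ^ f * 2 ^ (4 * f) \<le> l" using assms(2) by (simp flip: power_add)
  also have "l < 2 ^ f * (4 * r)" using assms(3) by simp
  finally have "2 ^ (4 * f) < 4 * r" by simp
  also have "4 * r < 2 ^ (u + 2)" using hi by simp
  finally have "4 * f < u + 2" by (simp add: power_strict_increasing_iff del: power_Suc power_add)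
  then have fu: "f + h \<le> u" "4 * f \<le> u + 1" using \<open>u \<noteq> 0\<close> unfolding h_def by linarith+
  have "4 * h + 13 \<le> 13 * 2 ^ h" by (induction h) auto
  moreover have "u \<le> 2 * h + 1" unfolding h_def by linarith
  ultimately have "width f r \<le> 13 * 2 ^ h"
    using fu(2) unfolding width_def u_def[symmetric] by linarith
  then have "2 ^ f * width f r \<le> 2 ^ f * (13 * 2 ^ h)" by (rule mult_left_mono) simp
  also have "\<dots> = 13 * 2 ^ (f + h)" by (simp add: power_add)
  also have "\<dots> \<le> 13 * 2 ^ u" using fu(1) by (intro mult_left_mono power_increasing) auto
  also have "\<dots> = 26 * 2 ^ (u - 1)" using \<open>u \<noteq> 0\<close> by (cases u) auto
  also have "\<dots> \<le> 26 * r" using lo by simp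
  finally show ?thesis .
qed

lemma leaf_length_table:
  assumes "rng A f x y \<noteq> 0" "2 ^ (5 * f) \<le> l"
  shows "length (encode A (l div 2) code 0 f x y) \<le> 182 * 2 ^ f * rng A f x y"
proof (cases "2 * 2 ^ f * rng A f x y \<le> l div 2")
  case True
  have "1 * 1 \<le> 2 ^ f * rng A f x y" using assms(1) by (intro mult_mono) (auto simp: Suc_leI)
  then have "8 * (2 ^ f * rng A f x y) + 1 \<le> 182 * (2 ^ f * rng A f x y)" by linarith
  then show ?thesis using True by (simp add: mult.assoc)
next
  case False
  have "2 ^ f * width f (rng A f x y) \<le> 26 * rng A f x y"
    using assms False by (intro width_le_large_range[of _ _ l]) auto
  then have le: "7 * 2 ^ f * (2 ^ f * width f (rng A f x y)) \<le> 7 * 2 ^ f * (26 * rng A f x y)"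
    by (rule mult_left_mono) simp
  have "length (encode A (l div 2) code 0 f x y) \<le> 7 * (2 ^ f * 2 ^ f * width f (rng A f x y))"
    by (rule leaf_length_direct[OF assms(1) False])
  also have "\<dots> \<le> 182 * 2 ^ f * rng A f x y" using le by (simp add: mult.assoc del: mult_le_cancel2 mult_le_cancel1)
  finally show ?thesis .
qed

text \<open>Six steps gain a factor of 5 because 5 (3/4)^6 = 3645/4096. For a starting size of at
  most \<open>E\<close> this factor gives \<open>2 ^ (5 * f) \<le> E\<close>, as the leaves with a
  table require.\<close>

lemma iterate_step_6: "5 ^ T * ((\<lambda>e. 3 * e div 4) ^^ (6 * T)) e \<le> (e :: nat)"
proof (induction T)
  case (Suc T)
  let ?g = "\<lambda>e :: nat. 3 * e div 4"
  have "5 * (?g ^^ 6) e \<le> e" for e :: nat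
  proof -
    define a where "a = (\<lambda>i. (?g ^^ i) e)"
    have "4 * a (Suc i) \<le> 3 * a i" for i by (simp add: a_def)
    from this[of 0] this[of 1] this[of 2] this[of 3] this[of 4] this[of 5]
    have "5 * a 6 \<le> a 0" by (simp add: eval_nat_numeral)
    then show ?thesis by (simp add: a_def)
  qed
  from mult_left_mono[OF this, of "5 ^ T" "(?g ^^ (6 * T)) e"]
  have "5 ^ Suc T * (?g ^^ (6 * Suc T)) e \<le> 5 ^ T * (?g ^^ (6 * T)) e"
    by (simp add: funpow_add mult_ac)
  then show ?case using Suc by linarith
qed simp

text \<open>With codes of at most \<open>E div 2\<close> bits there are about
  \<open>2 ^ (E div 2)\<close> records of order \<open>E * E\<close> bits; the other half of the
  exponent absorbs the polynomial factor.\<close>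

lemma table_length_le:
  fixes f E :: nat
  assumes "2 ^ (5 * f) \<le> E" 
  shows "2 ^ (E div 2 + 1) * grid_size f (E div 2) \<le> 1344 * 2 ^ E"
proof -
  define h where "h = E div 2"
  have E: "E \<le> 2 * h + 1" "2 * h \<le> E" unfolding h_def by linarith+
  have "(2::nat) ^ (2 * f) \<le> 2 ^ (5 * f)" by (intro power_increasing) auto
  then have f1: "2 ^ f * 2 ^ f \<le> E" using assms by (simp add: two_power_square)
  have "5 * f < 2 ^ (5 * f)" by (rule less_exp)
  then have f2: "4 * f \<le> E" using assms by linarith
  have E1: "1 \<le> E" using f1 by (metis less_one not_le mult_pos_pos zero_less_power pos2 le_0_eq neq0_conv)
  have "width f h \<le> 12 * E"
    using f2 E E1 floorlog_le_self[of h] unfolding width_def by linarith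
  then have "7 * (2 ^ f * 2 ^ f * width f h) \<le> 7 * (E * (12 * E))"
    using f1 by (intro mult_left_mono mult_mono) auto
  also have "\<dots> = 84 * (E * E)" by simp
  also have "\<dots> \<le> 84 * ((2 * h + 1) * (2 * h + 1))" using E by (intro mult_left_mono mult_mono) auto
  also have "\<dots> \<le> 84 * (8 * 2 ^ h)"
  proof (intro mult_left_mono)
    show "(2 * h + 1) * (2 * h + 1) \<le> 8 * 2 ^ h"
    proof (cases "h < 4")
      case True
      then have "h = 0 \<or> h = 1 \<or> h = 2 \<or> h = 3" by linarith
      then show ?thesis by auto
    next
      case False
      then have "4 \<le> h" by simp
      then show ?thesis
      proof (induction h rule: dec_induct)
        case (step k)
        have "(2 * Suc k + 1) * (2 * Suc k + 1) \<le> 2 * ((2 * k + 1) * (2 * k + 1))"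
        proof -
          have "(2 * Suc k + 1) * (2 * Suc k + 1) = 4 * (k * k) + 12 * k + 9"
            "2 * ((2 * k + 1) * (2 * k + 1)) = 8 * (k * k) + 8 * k + 2"
            by (simp_all add: algebra_simps)
          moreover have "4 * k \<le> k * k" using step(1) by (rule mult_le_mono1)
          ultimately show ?thesis using step(1) by linarith
        qed
        then show ?case using step by simp
      qed simp
    qed
  qed simp
  finally have "grid_size f h \<le> 672 * 2 ^ h" using grid_size_le[of f h] by linarith
  then have "2 ^ (h + 1) * grid_size f h \<le> 2 ^ (h + 1) * (672 * 2 ^ h)" by (rule mult_left_mono) simp
  also have "\<dots> = 1344 * 2 ^ (2 * h)" by (simp add: two_power_square)
  also have "\<dots> \<le> 1344 * 2 ^ E" using E by (intro mult_left_mono power_increasing) auto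
  finally show ?thesis by (simp only: h_def)
qed

text \<open>The last hypothesis says that the root entries, \<open>2 ^ (2 * (E - e))\<close> in
  number and of O(E) bits each, fit into O(n m) bits. To avoid division, the estimate is multiplied
  by the square of the block size. The constant is 1680 for the entries plus 61 for the fixed
  parts.\<close>

lemma root_length_le:
  fixes n m E e :: nat
  assumes "0 < m" "0 < E" "E \<le> n" "2 ^ E \<le> 2 * n" "e \<le> E" "n * E \<le> 4 * (2 ^ e * 2 ^ e) * m"
  shows "20 * E + 41 + 7 * (2 ^ (E - e) * 2 ^ (E - e) * (5 * E + 10)) \<le> 1741 * (n * m)"
proof -
  let ?q = "2 ^ (E - e) :: nat" and ?b = "2 ^ e :: nat"
  have qb: "?q * ?b = 2 ^ E" using assms by (simp flip: power_add)
  have "7 * (?q * ?q * (15 * E)) * (?b * ?b) = 105 * E * ((?q * ?b) * (?q * ?b))" by (simp add: mult_ac)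
  also have "\<dots> \<le> 105 * E * ((2 * n) * (2 * n))"
    unfolding qb using assms by (intro mult_left_mono mult_mono) auto
  also have "\<dots> = 420 * n * (n * E)" by simp
  also have "\<dots> \<le> 420 * n * (4 * (?b * ?b) * m)" using assms by (intro mult_left_mono) auto
  also have "\<dots> = 1680 * (n * m) * (?b * ?b)" by simp
  finally have 1: "7 * (?q * ?q * (15 * E)) \<le> 1680 * (n * m)" by simp
  have "7 * (?q * ?q * (5 * E + 10)) \<le> 7 * (?q * ?q * (15 * E))"
    using assms(2) by (intro mult_left_mono) auto
  moreover have "20 * E + 41 \<le> 61 * n" using assms by linarith
  moreover have "n \<le> n * m" using assms by simp
  ultimately show ?thesis using 1 by linarith
qed

lemma structure_exists:
  fixes A :: "nat \<Rightarrow> nat \<Rightarrow> nat" and n m k w :: nat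
  assumes A: "mono2 A" "\<And>i j. A i j < m" and nm: "m \<le> n" and w: "20 * floorlog 2 n + 21 \<le> w"
  shows "\<exists>D. real (length D) \<le> 80000 * (4 ^ k * real n * real m * (real n / real m) powr (1 / 2 ^ (2 ^ k))) \<and>
    (\<forall>i<n. \<forall>j<n. \<exists>t s'. exec w query (query_state w D i j) t s' \<and> regs s' 0 = A i j
      \<and> t \<le> ((cost body + 1) * 9 + cost prologue + 2) * 2 ^ k)"
proof -
  define E where "E = floorlog 2 n"
  define X where "X = (real n / real m) powr (1 / 2 ^ (2 ^ k))"
  have m0: "0 < m" using A(2)[of 0 0] by linarith
  then have n0: "0 < n" using nm by linarith
  have E: "0 < E" "2 ^ (E - 1) \<le> n" "n < 2 ^ E"
    using n0 floorlog_bounds[of n 2] unfolding E_def by (auto simp: floorlog_def)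
  have En: "E \<le> n" unfolding E_def by (rule floorlog_le_self)
  have E2: "2 ^ E \<le> 2 * n" using E by (cases E) auto
  have X1: "1 \<le> X" unfolding X_def using nm m0 by (intro ge_one_powr_ge_zero) auto
  have k1: "1 \<le> (2::nat) ^ k" "(2::nat) ^ k \<le> 4 ^ k" by (auto intro: power_mono)
  have main: "\<exists>D. length D \<le> 1741 * (n * m) + (1512 * L + F) * (4 * (n * m)) + tn * grid_size f \<beta> \<and>
    (\<forall>i<n. \<forall>j<n. \<exists>t s'. exec w query (query_state w D i j) t s' \<and> regs s' 0 = A i j
      \<and> t \<le> ((cost body + 1) * 9 + cost prologue + 2) * 2 ^ k)"
    if e: "e < E" and ne: "n * E \<le> 4 * (2 ^ e * 2 ^ e) * m" and \<beta>: "\<beta> \<le> E"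
      and f: "f = ((\<lambda>e. 3 * e div 4) ^^ L) e" and tn: "tn = (if \<beta> = 0 then 0 else 2 ^ (\<beta> + 1))"
      and leaf: "\<And>code x y. rng A f x y \<noteq> 0 \<Longrightarrow>
        length (encode A \<beta> code 0 f x y) \<le> F * 2 ^ f * rng A f x y"
      and L: "L \<le> 6 * 2 ^ k"
    for e \<beta> f L tn F :: nat
  proof -
    have "m < 2 ^ E" using nm E by linarith
    from trie_structure_exists[OF A this e \<beta> f tn _ leaf] w obtain D where
      D: "length D \<le> 20 * E + 41 + 7 * (2 ^ (E - e) * 2 ^ (E - e) * (5 * E + 10))
        + (1512 * L + F) * (2 * 2 ^ E * m) + tn * grid_size f \<beta>"
      and q: "\<And>i j. i < 2 ^ E \<Longrightarrow> j < 2 ^ E \<Longrightarrow> \<exists>t s'. exec w query (query_state w D i j) t s'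
        \<and> regs s' 0 = A i j \<and> t \<le> (cost body + 1) * (L + 3) + cost prologue + 2"
      unfolding E_def by blast
    have "2 * 2 ^ E * m \<le> 4 * (n * m)"
      using mult_right_mono[OF E2, of "2 * m"] by (simp add: mult_ac)
    then have "(1512 * L + F) * (2 * 2 ^ E * m) \<le> (1512 * L + F) * (4 * (n * m))"
      by (rule mult_left_mono) simp
    moreover have "20 * E + 41 + 7 * (2 ^ (E - e) * 2 ^ (E - e) * (5 * E + 10)) \<le> 1741 * (n * m)"
      using m0 E En E2 e ne by (intro root_length_le) auto
    ultimately have "length D \<le> 1741 * (n * m) + (1512 * L + F) * (4 * (n * m)) + tn * grid_size f \<beta>"
      by (intro order_trans[OF D] add_mono order_refl)
    moreover have "(cost body + 1) * (L + 3) + cost prologue + 2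
      \<le> ((cost body + 1) * 9 + cost prologue + 2) * 2 ^ k"
    proof -
      have "L + 3 \<le> 9 * 2 ^ k" using L k1(1) by linarith
      then have "(cost body + 1) * (L + 3) \<le> (cost body + 1) * (9 * 2 ^ k)"
        by (rule mult_left_mono) simp
      moreover have "(cost prologue + 2) * 1 \<le> (cost prologue + 2) * 2 ^ k"
        using k1(1) by (intro mult_left_mono) auto
      ultimately show ?thesis by (simp add: algebra_simps)
    qed
    moreover have "i < 2 ^ E" if "i < n" for i using that E by linarith
    ultimately show ?thesis using q by (meson le_trans)
  qed
  \<comment> \<open>The constant 41445 is 1741 + 4 * (1512 * 6 + 182) + 2688 from the case with a
    table; 36288 is 4 * 1512 * 6, for the \<open>6 * 2 ^ k\<close> levels of the other case, and 308
    is 4 * 77, for its leaves. The sum of the three is below 80000.\<close>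
  have real_bound: "real d \<le> 80000 * (4 ^ k * real n * real m * X)"
    if "real d \<le> (41445 + 36288 * 2 ^ k + 308 * X) * (real n * real m)" for d :: nat
  proof -
    have k: "1 \<le> (2::real) ^ k" "(2::real) ^ k \<le> 4 ^ k" by (auto intro: power_mono)
    have "2 ^ k * 1 \<le> 4 ^ k * X" "1 * X \<le> 4 ^ k * X"
      using k X1 by (intro mult_mono; simp)+
    then have "41445 + 36288 * 2 ^ k + 308 * X \<le> 80000 * (4 ^ k * X)" using k X1 by linarith
    then have "(41445 + 36288 * 2 ^ k + 308 * X) * (real n * real m)
        \<le> 80000 * (4 ^ k * X) * (real n * real m)"
      by (rule mult_right_mono) simp
    then show ?thesis using that by (simp add: mult_ac)
  qed
  show ?thesis
  \<comment> \<open>Compares n / m with the logarithm \<open>E\<close>; the larger one, up to a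
    factor of 2, becomes the starting size.\<close>
  proof (cases "E * m \<le> n")
    case True
    define \<rho> where "\<rho> = n div m"
    define e where "e = floorlog 2 \<rho> - 1"
    define L where "L = 6 * (2::nat) ^ k"
    define f where "f = ((\<lambda>e. 3 * e div 4) ^^ L) e"
    define F where "F = 7 * 2 ^ f * (4 * f + 11)"
    have \<rho>E: "E \<le> \<rho>" using True m0 by (simp add: \<rho>_def less_eq_div_iff_mult_less_eq)
    then have "0 < \<rho>" using E by linarith
    then have e: "2 ^ e \<le> \<rho>" "\<rho> < 2 * 2 ^ e"
      using floorlog_bounds[of \<rho> 2] by (auto simp: e_def floorlog_def)
    have "\<rho> \<le> n" by (simp add: \<rho>_def)
    then have "(2::nat) ^ e < 2 ^ E" using e E by linarith
    then have eE: "e < E" by (simp add: power_strict_increasing_iff)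
    have ne: "n * E \<le> 4 * (2 ^ e * 2 ^ e) * m"
    proof -
      have "n < (\<rho> + 1) * m" using m0 by (simp add: \<rho>_def dividend_less_div_times)
      also have "\<dots> \<le> (2 * 2 ^ e) * m" using e by (intro mult_right_mono) auto
      finally have "n * E \<le> (2 * 2 ^ e) * m * (2 * 2 ^ e)" using e \<rho>E by (intro mult_mono) auto
      then show ?thesis by (simp add: mult_ac)
    qed
    obtain D where D: "length D \<le> 1741 * (n * m) + (1512 * L + F) * (4 * (n * m)) + 0 * grid_size f 0"
      "\<forall>i<n. \<forall>j<n. \<exists>t s'. exec w query (query_state w D i j) t s' \<and> regs s' 0 = A i j
        \<and> t \<le> ((cost body + 1) * 9 + cost prologue + 2) * 2 ^ k"
      using main[of e 0 f L 0 F, OF eE ne _ f_def _ leaf_length_no_table[of A f, folded F_def]] unfolding L_def by auto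
    have FX: "real F \<le> 77 * X"
    proof -
      \<comment> \<open>The entry width is charged to another factor \<open>2 ^ f\<close>, which is
        why the square of the final block size has to be small.\<close>
      have "4 * f + 11 \<le> 11 * 2 ^ f" by (induction f) auto
      then have "F \<le> 7 * 2 ^ f * (11 * 2 ^ f)" unfolding F_def by (rule mult_left_mono) simp
      also have "\<dots> = 77 * 2 ^ (2 * f)" by (simp add: two_power_square)
      finally have "real F \<le> real (77 * 2 ^ (2 * f))" by (rule of_nat_mono)
      then have "real F \<le> 77 * 2 ^ (2 * f)" by simp
      moreover have "2 ^ (2 * f) \<le> X"
      proof -
        define N where "N = (2::nat) ^ 2 ^ k"
        \<comment> \<open>The exponent drops by a factor of \<open>5 ^ 2 ^ k\<close>:
          \<open>N\<close> of it pays for the root to be taken, and 2 for the square.\<close>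
        have "2 * N \<le> 5 ^ 2 ^ k"
        proof -
          have "2 * 2 ^ T \<le> (5::nat) ^ T" if "1 \<le> T" for T
            using that by (induction T rule: dec_induct) auto
          then show ?thesis unfolding N_def using k1(1) by blast
        qed
        then have "2 * N * f \<le> 5 ^ 2 ^ k * f" by (rule mult_right_mono) simp
        also have "\<dots> \<le> e" unfolding f_def L_def by (rule iterate_step_6)
        finally have "(2::real) ^ (2 * f * N) \<le> 2 ^ e" by (intro power_increasing) (auto simp: mult_ac)
        also have "\<dots> \<le> real \<rho>" using e(1) by (metis of_nat_le_iff of_nat_power of_nat_numeral)
        also have "\<dots> \<le> real n / real m" 
        proof -
          have "real (\<rho> * m) \<le> real n" unfolding \<rho>_def by (intro of_nat_mono div_times_less_eq_dividend)
          then show ?thesis using m0 by (simp add: le_divide_eq)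
        qed
        finally have "(2 ^ (2 * f)) ^ N \<le> real n / real m" by (simp only: power_mult)
        then have "((2 ^ (2 * f)) ^ N) powr (1 / real N) \<le> (real n / real m) powr (1 / real N)"
          by (intro powr_mono2) auto
        moreover have "((2 ^ (2 * f)) ^ N) powr (1 / real N) = 2 ^ (2 * f)"
          by (simp add: powr_realpow[symmetric] powr_powr N_def)
        ultimately show ?thesis by (simp add: X_def N_def)
      qed
      ultimately show ?thesis by linarith
    qed
    have "real (length D) \<le> real (1741 * (n * m) + (1512 * L + F) * (4 * (n * m)) + 0 * grid_size f 0)"
      using D(1) by (rule of_nat_mono)
    also have "\<dots> = (1741 + 36288 * 2 ^ k + 4 * real F) * (real n * real m)"
      by (simp add: L_def algebra_simps)
    also have "\<dots> \<le> (41445 + 36288 * 2 ^ k + 308 * X) * (real n * real m)"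
      using FX by (intro mult_right_mono) auto
    finally show ?thesis using real_bound D(2) unfolding X_def by blast
  next
    case False
    define e where "e = floorlog 2 E - 1"
    define f where "f = ((\<lambda>e. 3 * e div 4) ^^ 6) e"
    define tn where "tn = (if E div 2 = 0 then 0 else (2::nat) ^ (E div 2 + 1))"
    have e: "2 ^ e \<le> E" "E < 2 * 2 ^ e"
      using floorlog_bounds[of E 2] E by (auto simp: e_def floorlog_def)
    have "(2::nat) ^ e < 2 ^ E" using e less_exp[of E] by linarith
    then have eE: "e < E" by (simp add: power_strict_increasing_iff)
    have ne: "n * E \<le> 4 * (2 ^ e * 2 ^ e) * m"
    proof -
      have "n * E \<le> (E * m) * E" using False by (intro mult_right_mono) auto
      also have "\<dots> \<le> (2 * 2 ^ e * m) * (2 * 2 ^ e)" using e by (intro mult_mono) auto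
      finally show ?thesis by (simp add: mult_ac)
    qed
    have "5 * f \<le> e" using iterate_step_6[of 1 e] by (simp add: f_def)
    then have "(2::nat) ^ (5 * f) \<le> 2 ^ e" by (intro power_increasing) auto
    then have fE: "2 ^ (5 * f) \<le> E" using e by linarith
    obtain D where D: "length D \<le> 1741 * (n * m) + (1512 * 6 + 182) * (4 * (n * m)) + tn * grid_size f (E div 2)"
      "\<forall>i<n. \<forall>j<n. \<exists>t s'. exec w query (query_state w D i j) t s' \<and> regs s' 0 = A i j
        \<and> t \<le> ((cost body + 1) * 9 + cost prologue + 2) * 2 ^ k"
      using main[OF eE ne _ f_def tn_def leaf_length_table[OF _ fE]] k1 by auto
    have "tn * grid_size f (E div 2) \<le> 2 ^ (E div 2 + 1) * grid_size f (E div 2)"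
      unfolding tn_def by (intro mult_right_mono) auto
    also have "\<dots> \<le> 1344 * 2 ^ E" by (rule table_length_le[OF fE])
    also have "\<dots> \<le> 2688 * n" using E2 by simp
    also have "\<dots> \<le> 2688 * (n * m)" using m0 by simp
    finally have "length D \<le> 41445 * (n * m)" using D(1) by (simp add: mult.commute)
    then have "real (length D) \<le> real (41445 * (n * m))" by (rule of_nat_mono)
    also have "\<dots> = 41445 * (real n * real m)" by simp
    also have "\<dots> \<le> (41445 + 36288 * 2 ^ k + 308 * X) * (real n * real m)"
      using X1 by (intro mult_right_mono) auto
    finally show ?thesis using real_bound D(2) unfolding X_def by blast
  qed
qed

theorem theorem3:
  "\<exists>(P :: com) (c_word :: real) (c_space :: real) (c_time :: real).
     c_word \<ge> 1 \<and>
     (\<forall>(n :: nat) (m :: nat) (k :: nat) (A :: nat \<Rightarrow> nat \<Rightarrow> int) (w :: nat).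
        0 < m \<and> m \<le> n \<and> A \<in> IMS2 n m \<and> real w \<ge> c_word * log 2 (real n + 1) \<longrightarrow>
        (\<exists>D :: bool list.
           real (length D) \<le>
             c_space * (4 ^ k * real n * real m * (real n / real m) powr (1 / 2 ^ (2 ^ k))) \<and>
           accesses_in w P D n A (c_time * 2 ^ k)))"
proof (rule exI[of _ query], rule exI[of _ 61], rule exI[of _ 80000],
    rule exI[of _ "real ((cost body + 1) * 9 + cost prologue + 2)"], intro conjI allI impI)
  let ?c = "(cost body + 1) * 9 + cost prologue + 2"
  show "(1::real) \<le> 61" by simp
  fix n m k w :: nat and A :: "nat \<Rightarrow> nat \<Rightarrow> int"
  assume h: "0 < m \<and> m \<le> n \<and> A \<in> IMS2 n m \<and> real w \<ge> 61 * log 2 (real n + 1)"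
  then have n0: "0 < n" by linarith
  have row: "A i j \<le> A i j'" if "i < n" "j \<le> j'" "j' < n" for i j j'
    using that(2,3)
  proof (induction j' rule: dec_induct)
    case (step j')
    then show ?case using h that(1) by (force simp: IMS2_def)
  qed simp
  have col: "A i j \<le> A i' j" if "j < n" "i \<le> i'" "i' < n" for i i' j
    using that(2,3)
  proof (induction i' rule: dec_induct)
    case (step i')
    then show ?case using h that(1) by (force simp: IMS2_def)
  qed simp
  \<comment> \<open>Clamping the indices extends the array to a monotone function on all pairs, so
    that blocks may overhang its border.\<close>
  define B where "B = (\<lambda>i j. nat (A (min i (n - 1)) (min j (n - 1))))"
  have "mono2 B" unfolding mono2_def
  proof (intro allI impI)
    fix i i' j j' :: nat assume "i \<le> i'" "j \<le> j'"
    then have "A (min i (n - 1)) (min j (n - 1)) \<le> A (min i' (n - 1)) (min j (n - 1))"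
      "A (min i' (n - 1)) (min j (n - 1)) \<le> A (min i' (n - 1)) (min j' (n - 1))"
      using n0 by (auto intro!: row col)
    then show "B i j \<le> B i' j'" unfolding B_def by (intro nat_mono) linarith
  qed
  moreover have AB: "0 \<le> A i j \<and> A i j < int m" if "i < n" "j < n" for i j
    using h that by (auto simp: IMS2_def)
  then have "B i j < m" for i j
    using AB[of "min i (n - 1)" "min j (n - 1)"] n0 unfolding B_def by (simp add: nat_less_iff)
  \<comment> \<open>As \<open>floorlog 2 n\<close> exceeds the logarithm by at most 1 and the
    logarithm is at least 1, the word constant 61 arises as 20 + 20 + 21.\<close>
  moreover have "20 * floorlog 2 n + 21 \<le> w"
  proof -
    have "2 ^ (floorlog 2 n - 1) \<le> n" using floorlog_bounds[of n 2] n0 by auto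
    then have "(2::real) ^ (floorlog 2 n - 1) \<le> real n"
      by (metis of_nat_le_iff of_nat_power of_nat_numeral)
    then have "real (floorlog 2 n - 1) \<le> log 2 (real n)" by (intro le_log_of_power) auto
    also have "\<dots> \<le> log 2 (real n + 1)" using n0 by simp
    finally have 1: "real (floorlog 2 n) \<le> log 2 (real n + 1) + 1" by linarith
    have "log 2 2 \<le> log 2 (real n + 1)" using n0 by (intro log_mono) auto
    then have "1 \<le> log 2 (real n + 1)" by simp
    moreover have "61 * log 2 (real n + 1) \<le> real w" using h by simp
    ultimately have "20 * real (floorlog 2 n) + 21 \<le> real w" using 1 by linarith
    then show ?thesis by linarith
  qed
  ultimately obtain D where
    D: "real (length D) \<le> 80000 * (4 ^ k * real n * real m * (real n / real m) powr (1 / 2 ^ (2 ^ k)))"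
    and q: "\<And>i j. i < n \<Longrightarrow> j < n \<Longrightarrow> \<exists>t s'. exec w query (query_state w D i j) t s'
      \<and> regs s' 0 = B i j \<and> t \<le> ?c * 2 ^ k"
    using structure_exists[of B m n w k] h by blast
  have "accesses_in w query D n A (real ?c * 2 ^ k)"
    unfolding accesses_in_def
  proof (intro allI impI)
    fix i j assume ij: "i < n" "j < n"
    obtain t s' where t: "exec w query (query_state w D i j) t s'" "regs s' 0 = B i j" "t \<le> ?c * 2 ^ k"
      using q[OF ij] by blast
    have "min i (n - 1) = i" "min j (n - 1) = j" using ij by linarith+
    then have "int (regs s' 0) = A i j" using t(2) AB[OF ij] by (simp add: B_def)
    moreover have "real t \<le> real (?c * 2 ^ k)" using t(3) by (rule of_nat_mono)
    ultimately show "\<exists>t s'. exec w query (query_state w D i j) t s' \<and> int (regs s' 0) = A i j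
        \<and> real t \<le> real ?c * 2 ^ k"
      using t(1) by (intro exI[of _ t] exI[of _ s']) simp
  qed
  with D show "\<exists>D. real (length D)
      \<le> 80000 * (4 ^ k * real n * real m * (real n / real m) powr (1 / 2 ^ (2 ^ k)))
      \<and> accesses_in w query D n A (real ?c * 2 ^ k)" by blast
qed

end
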